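(* In the CONGEST model, any algorithm that solves Laplacian systems to accuracy $\epsilon\le\tfrac12$ requires at least $\widetilde{\Omega}(n^{1/2}+D)$ rounds of communication in the worst case. Here "solving a Laplacian system to accuracy $\epsilon$" means: given a weighted undirected graph $G$ (the communication network) with $n$ vertices and diameter $D$ and a vector $\vec b$ distributed over its vertices, output a vector $\vec x$ distributed over its vertices with $\|\vec x-\mathbf{L}(G)^\dagger\vec b\|_{\mathbf{L}(G)}\le\epsilon\|\vec b\|_{\mathbf{L}(G)^\dagger}$.
   Context: CONGEST model: nodes of the network have unique $O(\log n)$-bit IDs, know their neighbors and incident edge weights (positive, polynomially bounded in $n$), and communicate in synchronous rounds, each node sending an $O(\log n)$-bit message to each neighbor per round; $D$ is the unweighted diameter. $\mathbf{L}(G)$ is the weighted graph Laplacian (weighted degree matrix minus weighted adjacency matrix), $\dagger$ denotes the pseudoinverse, $\|\vec v\|_{\mathbf{M}}=\sqrt{\vec v^\top\mathbf{M}\vec v}$, and $\widetilde{\Omega}$ hides polylogarithmic factors in $n$. *)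

theory Defs
  imports "HOL-Probability.Probability" "Jordan_Normal_Form.Matrix"
begin

hide_const (open) Finite_Cartesian_Product.vec Finite_Cartesian_Product.mat
no_notation Finite_Cartesian_Product.vec_nth (infixl \<open>$\<close> 90)
no_notation Inner_Product.real_inner_class.inner (infix \<open>\<bullet>\<close> 70)

section \<open>Weighted networks\<close>

text \<open>
  The vertices are \<open>0, \<dots>, n - 1\<close>. They serve as matrix indices only: the name under which a
  node is known in the network is its identifier \<open>ident v\<close>. Weight 0 encodes the absence of an
  edge.
\<close>

record network =
  nverts :: nat
  ident :: "nat \<Rightarrow> nat"
  wt :: "nat \<Rightarrow> nat \<Rightarrow> nat"

definition adjacent :: "network \<Rightarrow> nat \<Rightarrow> nat \<Rightarrow> bool" where
  "adjacent G u v \<longleftrightarrow> u < nverts G \<and> v < nverts G \<and> wt G u v > 0"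

definition edge_rel :: "network \<Rightarrow> (nat \<times> nat) set" where
  "edge_rel G = {(u, v). adjacent G u v}"

definition hop_dist :: "network \<Rightarrow> nat \<Rightarrow> nat \<Rightarrow> nat" where
  "hop_dist G u v = (LEAST k. (u, v) \<in> edge_rel G ^^ k)"

definition diam :: "network \<Rightarrow> nat" where
  "diam G = Max {hop_dist G u v | u v. u < nverts G \<and> v < nverts G}"

text \<open>
  Identifiers and weights are polynomially bounded integers, that is, they have \<open>O(log n)\<close> bits;
  \<open>\<kappa>\<close> is the exponent of the polynomial.
\<close>

definition valid_network :: "nat \<Rightarrow> network \<Rightarrow> bool" where
  "valid_network \<kappa> G \<longleftrightarrow>
     nverts G > 0 \<and>
     inj_on (ident G) {..<nverts G} \<and>
     (\<forall>v<nverts G. ident G v < nverts G ^ \<kappa>) \<and>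
     (\<forall>u<nverts G. \<forall>v<nverts G.
        wt G u v = wt G v u \<and> wt G u v \<le> nverts G ^ \<kappa>) \<and>
     (\<forall>v<nverts G. wt G v v = 0) \<and>
     (\<forall>u<nverts G. \<forall>v<nverts G. (u, v) \<in> (edge_rel G)\<^sup>*)"

definition valid_rhs :: "nat \<Rightarrow> network \<Rightarrow> (nat \<Rightarrow> int) \<Rightarrow> bool" where
  "valid_rhs \<kappa> G b \<longleftrightarrow> (\<forall>v<nverts G. \<bar>b v\<bar> \<le> int (nverts G) ^ \<kappa>)"

section \<open>Laplacian systems\<close>

definition adjacency_mat :: "network \<Rightarrow> real mat" where
  "adjacency_mat G = mat (nverts G) (nverts G) (\<lambda>(u, v). real (wt G u v))"

definition degree_mat :: "network \<Rightarrow> real mat" where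
  "degree_mat G = mat (nverts G) (nverts G)
     (\<lambda>(u, v). if u = v then \<Sum>z<nverts G. real (wt G u z) else 0)"

definition laplacian :: "network \<Rightarrow> real mat" where
  "laplacian G = degree_mat G - adjacency_mat G"

text \<open>The four Penrose conditions, which determine the Moore--Penrose inverse uniquely.\<close>

definition is_pseudoinverse :: "real mat \<Rightarrow> real mat \<Rightarrow> bool" where
  "is_pseudoinverse M X \<longleftrightarrow>
     X \<in> carrier_mat (dim_col M) (dim_row M) \<and>
     M * X * M = M \<and> X * M * X = X \<and>
     transpose_mat (M * X) = M * X \<and> transpose_mat (X * M) = X * M"

definition pseudoinverse :: "real mat \<Rightarrow> real mat" where
  "pseudoinverse M = (THE X. is_pseudoinverse M X)"

definition mat_norm :: "real mat \<Rightarrow> real vec \<Rightarrow> real" where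
  "mat_norm M v = sqrt (v \<bullet> (M *\<^sub>v v))"

definition rhs_vec :: "network \<Rightarrow> (nat \<Rightarrow> int) \<Rightarrow> real vec" where
  "rhs_vec G b = vec (nverts G) (\<lambda>v. real_of_int (b v))"

definition laplacian_solution :: "real \<Rightarrow> network \<Rightarrow> (nat \<Rightarrow> int) \<Rightarrow> real vec \<Rightarrow> bool" where
  "laplacian_solution \<epsilon> G b x \<longleftrightarrow>
     mat_norm (laplacian G) (x - pseudoinverse (laplacian G) *\<^sub>v rhs_vec G b)
       \<le> \<epsilon> * mat_norm (pseudoinverse (laplacian G)) (rhs_vec G b)"

section \<open>The CONGEST model\<close>

text \<open>
  What a node knows initially: the number of nodes, its identifier, the identifiers of its
  neighbours with the weights of the connecting edges, and its entry of the right-hand side.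
\<close>

record local_input =
  net_size :: nat
  own_id :: nat
  nbrs :: "(nat \<times> nat) set"
  own_rhs :: int

type_synonym message = "bool list"

text \<open>
  The messages received by a node, tagged with the sender's identifier, one set per past round.
\<close>

type_synonym history = "(nat \<times> message) set list"

text \<open>An infinite string of private random bits.\<close>

type_synonym coins = "nat \<Rightarrow> bool"

text \<open>
  A node's state is its entire history, so local computation is unrestricted. The message sent in
  a round may depend on the (identifier of the) neighbour that receives it. \<open>outp\<close> returns \<open>None\<close>
  as long as the node has not yet settled on its output.
\<close>

record algorithm =
  send :: "local_input \<Rightarrow> coins \<Rightarrow> history \<Rightarrow> nat \<Rightarrow> message"
  outp :: "local_input \<Rightarrow> coins \<Rightarrow> history \<Rightarrow> real option"

text \<open>\<open>\<beta>\<close> is the constant hidden in the message length \<open>O(log n)\<close>.\<close>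

definition congest :: "real \<Rightarrow> algorithm \<Rightarrow> bool" where
  "congest \<beta> A \<longleftrightarrow>
     (\<forall>l c h i. real (length (send A l c h i)) \<le> \<beta> * log 2 (real (net_size l)))"

definition local_of :: "network \<Rightarrow> (nat \<Rightarrow> int) \<Rightarrow> nat \<Rightarrow> local_input" where
  "local_of G b v =
     \<lparr>net_size = nverts G, own_id = ident G v,
      nbrs = {(ident G u, wt G u v) | u. adjacent G u v}, own_rhs = b v\<rparr>"

fun hist :: "algorithm \<Rightarrow> network \<Rightarrow> (nat \<Rightarrow> int) \<Rightarrow> (nat \<Rightarrow> coins) \<Rightarrow> nat \<Rightarrow> nat \<Rightarrow> history" where
  "hist A G b \<omega> 0 v = []"
| "hist A G b \<omega> (Suc t) v = hist A G b \<omega> t v @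
     [{(ident G u, send A (local_of G b u) (\<omega> u) (hist A G b \<omega> t u) (ident G v)) | u.
        adjacent G u v}]"

definition outp_at ::
  "algorithm \<Rightarrow> network \<Rightarrow> (nat \<Rightarrow> int) \<Rightarrow> (nat \<Rightarrow> coins) \<Rightarrow> nat \<Rightarrow> nat \<Rightarrow> real option" where
  "outp_at A G b \<omega> t v = outp A (local_of G b v) (\<omega> v) (hist A G b \<omega> t v)"

definition finishes_within ::
  "algorithm \<Rightarrow> network \<Rightarrow> (nat \<Rightarrow> int) \<Rightarrow> (nat \<Rightarrow> coins) \<Rightarrow> nat \<Rightarrow> bool" where
  "finishes_within A G b \<omega> r \<longleftrightarrow> (\<forall>v<nverts G. \<exists>t\<le>r. outp_at A G b \<omega> t v \<noteq> None)"

text \<open>A node's first output is final.\<close>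

definition result ::
  "algorithm \<Rightarrow> network \<Rightarrow> (nat \<Rightarrow> int) \<Rightarrow> (nat \<Rightarrow> coins) \<Rightarrow> real vec" where
  "result A G b \<omega> = vec (nverts G)
     (\<lambda>v. the (outp_at A G b \<omega> (LEAST t. outp_at A G b \<omega> t v \<noteq> None) v))"

definition coin_measure :: "(nat \<Rightarrow> coins) measure" where
  "coin_measure = Pi\<^sub>M UNIV (\<lambda>_. Pi\<^sub>M UNIV (\<lambda>_. measure_pmf (bernoulli_pmf (1/2))))"

text \<open>
  \<open>T n D\<close> bounds the number of rounds on every input with \<open>n\<close> vertices and diameter \<open>D\<close>. Algorithms
  may be randomized with success probability 2/3; deterministic ones ignore their coins. As
  \<open>send\<close> and \<open>outp\<close> are arbitrary functions of the coins, the set of successful outcomes need not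
  be measurable; it is required to contain a measurable set of probability 2/3.
\<close>

definition solves_laplacian_within ::
  "nat \<Rightarrow> real \<Rightarrow> algorithm \<Rightarrow> (nat \<Rightarrow> nat \<Rightarrow> nat) \<Rightarrow> bool" where
  "solves_laplacian_within \<kappa> \<epsilon> A T \<longleftrightarrow>
     (\<forall>G b. valid_network \<kappa> G \<and> valid_rhs \<kappa> G b \<longrightarrow>
        (\<exists>S\<in>sets coin_measure. measure coin_measure S \<ge> 2/3 \<and>
           (\<forall>\<omega>\<in>S. finishes_within A G b \<omega> (T (nverts G) (diam G)) \<and>
                  laplacian_solution \<epsilon> G b (result A G b \<omega>))))"

end

theory Submission
  imports Defs "Jordan_Normal_Form.Determinant"
begin

text \<open>
  Only the right-hand side carries information. Fix the coins by averaging, and let a family of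
  right-hand sides differ only on a set of vertices far from a \<^emph>\<open>target\<close> set of edges that carries
  most of the energy of the solution. An approximation in the \<open>L\<close>-norm then has to reveal, on the
  target alone, most of the bits that define the right-hand side.

  If \<open>D \<ge> sqrt n\<close>, the network is a path with a light middle edge, with right-hand side \<open>\<plusminus>D\<close> at its
  two ends: fewer than \<open>D/2 - 1\<close> rounds do not bring the sign to the middle.

  If \<open>D < sqrt n\<close>, the network consists of \<open>2m\<close> parallel rows with \<open>2 ^ h \<approx> sqrt n\<close> columns, and
  of a binary tree with one leaf per column, which is joined to all rows in that column. The rows
  come in pairs that get opposite currents \<open>\<plusminus>s\<^sub>i\<close> in column 0; by antisymmetry the tree stays at
  potential 0, the rows decouple, and the edge weights are chosen so that the potential is linear
  along each row and most of the energy sits in the last column. Information reaches the last column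
  in fewer than \<open>2 ^ h - 1\<close> rounds only through the tree, where at most \<open>h\<close> messages per round enter
  the region still unaffected. Hence the outputs in the last column take at most \<open>2 ^ O(T log\<^sup>2 n)\<close>
  values, and each of them is compatible with at most a Hamming ball of radius \<open>m/3\<close> of sign
  patterns. A tail and pendant vertices at the root adjust \<open>D\<close> and \<open>n\<close>.
\<close>

section \<open>The pseudoinverse of a Laplacian\<close>

lemma is_pseudoinverse_transpose:
  assumes "is_pseudoinverse M X"
  shows "is_pseudoinverse M\<^sup>T X\<^sup>T"
proof -
  have M: "M \<in> carrier_mat (dim_row M) (dim_col M)"
    and X: "X \<in> carrier_mat (dim_col M) (dim_row M)"
    using assms by (auto simp: is_pseudoinverse_def)
  have MX: "M * X \<in> carrier_mat (dim_row M) (dim_row M)"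
    and XM: "X * M \<in> carrier_mat (dim_col M) (dim_col M)"
    using mult_carrier_mat[OF M X] mult_carrier_mat[OF X M] .
  have "M\<^sup>T * X\<^sup>T = (X * M)\<^sup>T" "X\<^sup>T * M\<^sup>T = (M * X)\<^sup>T"
    using transpose_mult[OF X M] transpose_mult[OF M X] by simp_all
  moreover have "(X * M)\<^sup>T * M\<^sup>T = (M * X * M)\<^sup>T" "(M * X)\<^sup>T * X\<^sup>T = (X * M * X)\<^sup>T"
    using transpose_mult[OF M XM] transpose_mult[OF X MX]
      assoc_mult_mat[OF M X M] assoc_mult_mat[OF X M X] by simp_all
  ultimately show ?thesis using assms by (auto simp: is_pseudoinverse_def)
qed

lemma is_pseudoinverse_range_projection_unique:
  assumes X: "is_pseudoinverse M X" and Y: "is_pseudoinverse M Y"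
  shows "M * X = M * Y"
proof -
  have M: "M \<in> carrier_mat (dim_row M) (dim_col M)"
    and Xc: "X \<in> carrier_mat (dim_col M) (dim_row M)"
    and Yc: "Y \<in> carrier_mat (dim_col M) (dim_row M)"
    using X Y by (auto simp: is_pseudoinverse_def)
  have MX: "M * X \<in> carrier_mat (dim_row M) (dim_row M)"
    and MY: "M * Y \<in> carrier_mat (dim_row M) (dim_row M)"
    using mult_carrier_mat[OF M Xc] mult_carrier_mat[OF M Yc] .
  have "M * X = (M * Y * M) * X" using Y by (simp only: is_pseudoinverse_def)
  also have "\<dots> = (M * Y) * (M * X)" by (rule assoc_mult_mat[OF MY M Xc])
  finally have "M * X = ((M * Y) * (M * X))\<^sup>T" using X by (simp add: is_pseudoinverse_def)
  also have "\<dots> = (M * X)\<^sup>T * (M * Y)\<^sup>T" by (rule transpose_mult[OF MY MX])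
  also have "\<dots> = (M * X) * (M * Y)" using X Y by (simp only: is_pseudoinverse_def)
  also have "\<dots> = (M * X * M) * Y" by (rule assoc_mult_mat[OF MX M Yc, symmetric])
  also have "\<dots> = M * Y" using X by (simp only: is_pseudoinverse_def)
  finally show ?thesis .
qed

lemma is_pseudoinverse_unique:
  assumes X: "is_pseudoinverse M X" and Y: "is_pseudoinverse M Y"
  shows "X = Y"
proof -
  have M: "M \<in> carrier_mat (dim_row M) (dim_col M)"
    and Xc: "X \<in> carrier_mat (dim_col M) (dim_row M)"
    and Yc: "Y \<in> carrier_mat (dim_col M) (dim_row M)"
    using X Y by (auto simp: is_pseudoinverse_def)
  have MX_MY: "M * X = M * Y" by (rule is_pseudoinverse_range_projection_unique[OF X Y])
  have "(X * M)\<^sup>T = (Y * M)\<^sup>T"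
    using is_pseudoinverse_range_projection_unique[OF X[THEN is_pseudoinverse_transpose]
        Y[THEN is_pseudoinverse_transpose]] transpose_mult[OF Xc M] transpose_mult[OF Yc M]
    by simp
  then have XM_YM: "X * M = Y * M" by simp
  have "X = (X * M) * X" using X by (simp only: is_pseudoinverse_def)
  also have "\<dots> = Y * (M * X)" unfolding XM_YM by (rule assoc_mult_mat[OF Yc M Xc])
  also have "\<dots> = (Y * M) * Y" unfolding MX_MY by (rule assoc_mult_mat[OF Yc M Yc, symmetric])
  also have "\<dots> = Y" using Y by (simp only: is_pseudoinverse_def)
  finally show ?thesis .
qed

lemma pseudoinverse_eqI: "is_pseudoinverse M X \<Longrightarrow> pseudoinverse M = X"
  unfolding pseudoinverse_def by (rule the_equality) (auto intro: is_pseudoinverse_unique)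

lemma is_pseudoinverse_inverse_minus_projection:
  assumes L: "L \<in> carrier_mat n n" "L\<^sup>T = L"
    and J: "J \<in> carrier_mat n n" "J\<^sup>T = J" "J * J = J"
    and LJ: "L * J = 0\<^sub>m n n"
    and N: "N \<in> carrier_mat n n" "N * (L + J) = 1\<^sub>m n" "(L + J) * N = 1\<^sub>m n"
  shows "is_pseudoinverse L (N - J)"
proof -
  define M where "M = L + J"
  have M: "M \<in> carrier_mat n n" and NM: "N * M = 1\<^sub>m n" and MN: "M * N = 1\<^sub>m n"
    using J(1) N by (simp_all add: M_def)
  have L_eq: "L = M - J" unfolding M_def using L(1) J(1) by (intro eq_matI) auto
  have JL: "J * L = 0\<^sub>m n n"
    using transpose_mult[OF L(1) J(1)] L J LJ by simp
  have MJ: "M * J = J" and JM: "J * M = J"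
    unfolding M_def add_mult_distrib_mat[OF L(1) J(1) J(1)] mult_add_distrib_mat[OF J(1) L(1) J(1)]
    using J by (simp_all add: LJ JL)
  have NJ: "N * J = J"
    using assoc_mult_mat[OF N(1) M J(1)] left_mult_one_mat[OF J(1)] by (simp only: MJ NM)
  have JN: "J * N = J"
    using assoc_mult_mat[OF J(1) M N(1)] right_mult_one_mat[OF J(1)] by (simp only: JM MN)
  have carrier: "N - J \<in> carrier_mat n n" "1\<^sub>m n - J \<in> carrier_mat n n"
    using J(1) by (simp_all add: minus_carrier_mat)
  have minus_zero: "A - 0\<^sub>m n n = A" if "A \<in> carrier_mat n n" for A :: "real mat"
    using that by (intro eq_matI) auto
  have "L * N = 1\<^sub>m n - J"
    unfolding L_eq minus_mult_distrib_mat[OF M J(1) N(1)] by (simp only: MN JN)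
  then have LX: "L * (N - J) = 1\<^sub>m n - J"
    using carrier by (simp add: mult_minus_distrib_mat[OF L(1) N(1) J(1)] LJ minus_zero)
  have "N * L = 1\<^sub>m n - J"
    unfolding L_eq mult_minus_distrib_mat[OF N(1) M J(1)] by (simp only: NM NJ)
  then have XL: "(N - J) * L = 1\<^sub>m n - J"
    using carrier by (simp add: minus_mult_distrib_mat[OF N(1) J(1) L(1)] JL minus_zero)
  have "J * (N - J) = 0\<^sub>m n n"
    using J by (simp add: mult_minus_distrib_mat[OF J(1) N(1) J(1)] JN)
  then have "L * (N - J) * L = L" "(N - J) * L * (N - J) = N - J"
    unfolding LX XL minus_mult_distrib_mat[OF one_carrier_mat J(1) L(1)]
      minus_mult_distrib_mat[OF one_carrier_mat J(1) carrier(1)]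
    using L(1) carrier(1) by (simp_all only: JL left_mult_one_mat minus_zero)
  moreover have "(1\<^sub>m n - J)\<^sup>T = 1\<^sub>m n - J" using J by (simp add: transpose_minus[of _ n n])
  ultimately show ?thesis using L(1) carrier(1) by (auto simp: is_pseudoinverse_def LX XL)
qed

definition net_current :: "network \<Rightarrow> (nat \<Rightarrow> real) \<Rightarrow> nat \<Rightarrow> real" where
  "net_current G f v = (\<Sum>u<nverts G. real (wt G v u) * (f v - f u))"

definition dirichlet_energy :: "network \<Rightarrow> (nat \<Rightarrow> real) \<Rightarrow> real" where
  "dirichlet_energy G f =
     (\<Sum>u<nverts G. \<Sum>v<nverts G. real (wt G u v) * (f u - f v)\<^sup>2) / 2"

lemma net_current_diff:
  "net_current G (\<lambda>v. f v - g v) v = net_current G f v - net_current G g v"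
  by (simp add: net_current_def sum_subtractf[symmetric] algebra_simps)

lemma dirichlet_energy_nonneg: "0 \<le> dirichlet_energy G f"
  by (simp add: dirichlet_energy_def sum_nonneg)

lemma dirichlet_energy_cong:
  assumes "\<And>u v. u < nverts G \<Longrightarrow> v < nverts G \<Longrightarrow> f u - f v = g u - g v"
  shows "dirichlet_energy G f = dirichlet_energy G g"
  using assms by (simp add: dirichlet_energy_def)

lemma sum_mult_net_current:
  assumes sym: "\<And>u v. u < nverts G \<Longrightarrow> v < nverts G \<Longrightarrow> wt G u v = wt G v u"
  shows "(\<Sum>v<nverts G. f v * net_current G f v) = dirichlet_energy G f"
proof -
  let ?n = "nverts G"
  have "(\<Sum>v<?n. f v * net_current G f v)
      = (\<Sum>v<?n. \<Sum>u<?n. real (wt G v u) * (f v - f u) * f v)"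
    by (simp add: net_current_def sum_distrib_left mult_ac)
  moreover have "\<dots> = (\<Sum>v<?n. \<Sum>u<?n. real (wt G v u) * (f u - f v) * f u)"
    by (subst sum.swap) (simp add: sym)
  moreover have "(\<Sum>v<?n. \<Sum>u<?n. real (wt G v u) * (f v - f u) * f v)
      + (\<Sum>v<?n. \<Sum>u<?n. real (wt G v u) * (f u - f v) * f u) = 2 * dirichlet_energy G f"
    by (simp add: dirichlet_energy_def sum.distrib[symmetric] power2_eq_square algebra_simps)
  ultimately show ?thesis by simp
qed

lemma dirichlet_energy_eq_0_imp_const:
  assumes valid: "valid_network \<kappa> G" and energy: "dirichlet_energy G f = 0"
    and vertices: "u < nverts G" "v < nverts G"
  shows "f u = f v"
proof -
  have edge: "f a = f c" if "(a, c) \<in> edge_rel G" for a c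
  proof -
    have ac: "a < nverts G" "c < nverts G" "wt G a c > 0"
      using that by (auto simp: edge_rel_def adjacent_def)
    have "(\<Sum>u<nverts G. \<Sum>v<nverts G. real (wt G u v) * (f u - f v)\<^sup>2) = 0"
      using energy by (simp add: dirichlet_energy_def)
    then have "\<forall>u<nverts G. \<forall>v<nverts G. real (wt G u v) * (f u - f v)\<^sup>2 = 0"
      by (simp add: sum_nonneg_eq_0_iff sum_nonneg Ball_def)
    then have "real (wt G a c) * (f a - f c)\<^sup>2 = 0" using ac by blast
    then show ?thesis using ac by simp
  qed
  have "(u, v) \<in> (edge_rel G)\<^sup>*" using valid vertices by (simp add: valid_network_def)
  then show ?thesis by (induction rule: rtrancl_induct) (auto dest: edge)
qed

lemma net_current_eq_imp_diff_eq:
  assumes valid: "valid_network \<kappa> G"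
    and current: "\<And>v. v < nverts G \<Longrightarrow> net_current G f v = net_current G g v"
    and vertices: "u < nverts G" "v < nverts G"
  shows "f u - f v = g u - g v"
proof -
  have "dirichlet_energy G (\<lambda>v. f v - g v) = 0"
    using valid sum_mult_net_current[of G "\<lambda>v. f v - g v"] current
    by (simp add: valid_network_def net_current_diff)
  from dirichlet_energy_eq_0_imp_const[OF valid this vertices] show ?thesis by simp
qed

lemma laplacian_carrier [simp]: "laplacian G \<in> carrier_mat (nverts G) (nverts G)"
  by (auto simp: laplacian_def degree_mat_def adjacency_mat_def)

lemma transpose_laplacian:
  assumes "valid_network \<kappa> G"
  shows "(laplacian G)\<^sup>T = laplacian G"
  using assms
  by (intro eq_matI) (auto simp: laplacian_def degree_mat_def adjacency_mat_def valid_network_def)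

lemma laplacian_mult_vec:
  assumes "v < nverts G" "dim_vec y = nverts G"
  shows "(laplacian G *\<^sub>v y) $ v = net_current G (($) y) v"
proof -
  let ?n = "nverts G"
  have "(laplacian G *\<^sub>v y) $ v = (\<Sum>u<?n.
      ((if v = u then \<Sum>z<?n. real (wt G v z) else 0) - real (wt G v u)) * y $ u)"
    using assms
    by (simp add: laplacian_def degree_mat_def adjacency_mat_def scalar_prod_def atLeast0LessThan)
  also have "\<dots> = (\<Sum>u<?n. (if v = u then (\<Sum>z<?n. real (wt G v z)) * y $ u else 0)
      - real (wt G v u) * y $ u)"
    by (intro sum.cong) (auto simp: algebra_simps)
  also have "\<dots> = (\<Sum>z<?n. real (wt G v z)) * y $ v - (\<Sum>u<?n. real (wt G v u) * y $ u)"
    using assms by (simp add: sum_subtractf)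
  finally show ?thesis
    by (simp add: net_current_def sum_distrib_right sum_subtractf right_diff_distrib)
qed

lemma scalar_prod_laplacian:
  assumes valid: "valid_network \<kappa> G" and y: "dim_vec y = nverts G"
  shows "y \<bullet> (laplacian G *\<^sub>v y) = dirichlet_energy G (($) y)"
proof -
  have "y \<bullet> (laplacian G *\<^sub>v y) = (\<Sum>v<nverts G. y $ v * (laplacian G *\<^sub>v y) $ v)"
    using carrier_matD(1)[OF laplacian_carrier[of G]]
    by (simp add: scalar_prod_def atLeast0LessThan)
  also have "\<dots> = (\<Sum>v<nverts G. y $ v * net_current G (($) y) v)"
    using y by (simp add: laplacian_mult_vec del: index_mult_mat_vec)
  also have "\<dots> = dirichlet_energy G (($) y)"
    using valid by (intro sum_mult_net_current) (simp add: valid_network_def)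
  finally show ?thesis .
qed

definition mean_mat :: "nat \<Rightarrow> real mat" where
  "mean_mat n = mat n n (\<lambda>_. 1 / real n)"

lemma mean_mat_carrier [simp]: "mean_mat n \<in> carrier_mat n n"
  by (simp add: mean_mat_def)

lemma transpose_mean_mat: "(mean_mat n)\<^sup>T = mean_mat n"
  by (rule eq_matI) (auto simp: mean_mat_def)

lemma mean_mat_idempotent: "mean_mat n * mean_mat n = mean_mat n"
  by (rule eq_matI) (auto simp: mean_mat_def scalar_prod_def)

lemma scalar_prod_mean_mat:
  assumes "dim_vec v = n"
  shows "v \<bullet> (mean_mat n *\<^sub>v v) = (\<Sum>i<n. v $ i)\<^sup>2 / real n"
proof -
  have "v \<bullet> (mean_mat n *\<^sub>v v) = (\<Sum>i<n. v $ i * ((\<Sum>j<n. v $ j) / real n))"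
    using assms by (simp add: scalar_prod_def mean_mat_def atLeast0LessThan sum_divide_distrib)
  also have "\<dots> = (\<Sum>i<n. v $ i)\<^sup>2 / real n"
    by (subst sum_distrib_right[symmetric]) (simp add: power2_eq_square)
  finally show ?thesis .
qed

lemma laplacian_mult_mean_mat:
  "laplacian G * mean_mat (nverts G) = 0\<^sub>m (nverts G) (nverts G)"
proof (rule eq_matI)
  fix i j
  assume "i < dim_row (0\<^sub>m (nverts G) (nverts G) :: real mat)"
    and "j < dim_col (0\<^sub>m (nverts G) (nverts G) :: real mat)"
  then have ij: "i < nverts G" "j < nverts G" by auto
  then have "(laplacian G * mean_mat (nverts G)) $$ (i, j)
      = (laplacian G *\<^sub>v col (mean_mat (nverts G)) j) $ i"
    using carrier_matD[OF laplacian_carrier[of G]] by (simp add: mean_mat_def)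
  also have "\<dots> = 0"
    using ij by (subst laplacian_mult_vec) (auto simp: net_current_def mean_mat_def)
  finally show "(laplacian G * mean_mat (nverts G)) $$ (i, j)
      = 0\<^sub>m (nverts G) (nverts G) $$ (i, j)" using ij by simp
qed (use carrier_matD[OF laplacian_carrier[of G]] in \<open>auto simp: mean_mat_def\<close>)

lemma laplacian_plus_mean_mat_kernel:
  assumes valid: "valid_network \<kappa> G" and v: "v \<in> carrier_vec (nverts G)"
    and kernel: "(laplacian G + mean_mat (nverts G)) *\<^sub>v v = 0\<^sub>v (nverts G)"
  shows "v = 0\<^sub>v (nverts G)"
proof -
  let ?n = "nverts G" and ?L = "laplacian G" and ?J = "mean_mat (nverts G)"
  have n: "?n > 0" using valid by (simp add: valid_network_def)
  have dim: "dim_vec v = ?n" using v by simp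
  have "0 = v \<bullet> ((?L + ?J) *\<^sub>v v)" using v kernel by simp
  also have "(?L + ?J) *\<^sub>v v = ?L *\<^sub>v v + ?J *\<^sub>v v"
    using v by (intro add_mult_distrib_mat_vec[of _ ?n ?n]) auto
  also have "v \<bullet> \<dots> = v \<bullet> (?L *\<^sub>v v) + v \<bullet> (?J *\<^sub>v v)"
    using v by (intro scalar_prod_add_distrib[of _ ?n] mult_mat_vec_carrier[of _ ?n ?n]) auto
  also have "\<dots> = dirichlet_energy G (($) v) + (\<Sum>i<?n. v $ i)\<^sup>2 / real ?n"
    using dim by (simp add: scalar_prod_laplacian[OF valid] scalar_prod_mean_mat)
  finally have "0 = dirichlet_energy G (($) v) + (\<Sum>i<?n. v $ i)\<^sup>2 / real ?n" .
  moreover have "0 \<le> (\<Sum>i<?n. v $ i)\<^sup>2 / real ?n" by simp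
  ultimately have energy: "dirichlet_energy G (($) v) = 0"
    and mean: "(\<Sum>i<?n. v $ i)\<^sup>2 / real ?n = 0"
    using dirichlet_energy_nonneg[of G "($) v"] by linarith+
  have const: "v $ i = v $ 0" if "i < ?n" for i
    using dirichlet_energy_eq_0_imp_const[OF valid energy that n] .
  have "(\<Sum>i<?n. v $ i) = (\<Sum>i<?n. v $ 0)" by (rule sum.cong) (auto intro: const)
  then have "v $ 0 = 0" using mean n by simp
  then have "v $ i = 0" if "i < ?n" for i using const[OF that] by simp
  then show ?thesis using dim by (intro eq_vecI) auto
qed

text \<open>
  \<open>J = mean_mat n\<close> projects onto the constant vectors, which form the kernel of the Laplacian of a
  connected network; therefore \<open>L + J\<close> is invertible and the pseudoinverse is \<open>(L + J)\<inverse> - J\<close>.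
\<close>

lemma is_pseudoinverse_laplacian:
  assumes valid: "valid_network \<kappa> G"
  shows "is_pseudoinverse (laplacian G) (pseudoinverse (laplacian G))"
proof -
  let ?n = "nverts G" and ?J = "mean_mat (nverts G)"
  let ?M = "laplacian G + ?J"
  have M: "?M \<in> carrier_mat ?n ?n" by simp
  have "det ?M \<noteq> 0"
    using det_0_iff_vec_prod_zero[OF M] laplacian_plus_mean_mat_kernel[OF valid] by blast
  from det_non_zero_imp_unit[OF M this, where b = "()"]
  obtain N where "N \<in> carrier_mat ?n ?n" "N * ?M = 1\<^sub>m ?n" "?M * N = 1\<^sub>m ?n"
    by (auto simp: Units_def ring_mat_def)
  then have "is_pseudoinverse (laplacian G) (N - ?J)"
    by (intro is_pseudoinverse_inverse_minus_projection[of _ ?n])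
      (simp_all add: transpose_laplacian[OF valid] transpose_mean_mat mean_mat_idempotent
        laplacian_mult_mean_mat)
  then show ?thesis by (simp add: pseudoinverse_eqI)
qed

definition is_potential :: "network \<Rightarrow> (nat \<Rightarrow> int) \<Rightarrow> (nat \<Rightarrow> real) \<Rightarrow> bool" where
  "is_potential G b y \<longleftrightarrow> (\<forall>v<nverts G. net_current G y v = real_of_int (b v))"

lemma is_potential_pseudoinverse:
  assumes valid: "valid_network \<kappa> G" and potential: "is_potential G b y"
  shows "is_potential G b (($) (pseudoinverse (laplacian G) *\<^sub>v rhs_vec G b))"
proof -
  let ?n = "nverts G" and ?L = "laplacian G" and ?X = "pseudoinverse (laplacian G)"
  have L: "?L \<in> carrier_mat ?n ?n" by simp
  have X: "?X \<in> carrier_mat ?n ?n" and LXL: "?L * ?X * ?L = ?L"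
    using is_pseudoinverse_laplacian[OF valid] carrier_matD[OF L]
    by (auto simp: is_pseudoinverse_def)
  have rhs: "?L *\<^sub>v vec ?n y = rhs_vec G b"
  proof (rule eq_vecI)
    fix v assume "v < dim_vec (rhs_vec G b)"
    then have v: "v < ?n" by (simp add: rhs_vec_def)
    have "(?L *\<^sub>v vec ?n y) $ v = net_current G y v"
      using v by (subst laplacian_mult_vec) (simp_all add: net_current_def)
    then show "(?L *\<^sub>v vec ?n y) $ v = rhs_vec G b $ v"
      using potential v by (simp add: is_potential_def rhs_vec_def)
  qed (use carrier_matD[OF L] in \<open>simp add: rhs_vec_def\<close>)
  have "?L *\<^sub>v (?X *\<^sub>v (?L *\<^sub>v vec ?n y)) = (?L * ?X * ?L) *\<^sub>v vec ?n y"
    using assoc_mult_mat_vec[OF mult_carrier_mat[OF L X] L, of "vec ?n y"]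
      assoc_mult_mat_vec[OF L X mult_mat_vec_carrier[OF L, of "vec ?n y"]] by simp
  then have "?L *\<^sub>v (?X *\<^sub>v rhs_vec G b) = rhs_vec G b" by (simp only: LXL rhs)
  then have "net_current G (($) (?X *\<^sub>v rhs_vec G b)) v = rhs_vec G b $ v" if "v < ?n" for v
    using laplacian_mult_vec[OF that, of "?X *\<^sub>v rhs_vec G b"] carrier_matD[OF X] by simp
  then show ?thesis by (simp add: is_potential_def rhs_vec_def)
qed

text \<open>
  Potentials are unique up to a constant, so both norms in the accuracy requirement can be computed
  from an arbitrary preimage \<open>y\<close> of \<open>b\<close> under \<open>L\<close>.
\<close>

lemma laplacian_solution_iff:
  assumes valid: "valid_network \<kappa> G" and potential: "is_potential G b y"
    and dim_x: "dim_vec x = nverts G"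
  shows "laplacian_solution \<epsilon> G b x \<longleftrightarrow>
    sqrt (dirichlet_energy G (\<lambda>v. x $ v - y v)) \<le> \<epsilon> * sqrt (dirichlet_energy G y)"
proof -
  define z where "z = pseudoinverse (laplacian G) *\<^sub>v rhs_vec G b"
  have z: "is_potential G b (($) z)"
    unfolding z_def by (rule is_potential_pseudoinverse[OF valid potential])
  have dim_z: "dim_vec z = nverts G"
    using is_pseudoinverse_laplacian[OF valid] carrier_matD[OF laplacian_carrier[of G]]
    by (auto simp: z_def is_pseudoinverse_def)
  have diff: "z $ u - z $ v = y u - y v" if "u < nverts G" "v < nverts G" for u v
    using net_current_eq_imp_diff_eq[OF valid _ that, of "($) z" y] potential z
    by (simp add: is_potential_def)
  have "(x - z) \<bullet> (laplacian G *\<^sub>v (x - z)) = dirichlet_energy G (($) (x - z))"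
    using dim_x dim_z by (intro scalar_prod_laplacian[OF valid]) simp
  also have "\<dots> = dirichlet_energy G (\<lambda>v. x $ v - y v)"
  proof (rule dirichlet_energy_cong)
    fix u v assume "u < nverts G" "v < nverts G"
    then show "(x - z) $ u - (x - z) $ v = x $ u - y u - (x $ v - y v)"
      using diff[of u v] dim_z by simp
  qed
  finally have error: "(x - z) \<bullet> (laplacian G *\<^sub>v (x - z)) = dirichlet_energy G (\<lambda>v. x $ v - y v)" .
  have "rhs_vec G b \<bullet> z = (\<Sum>v<nverts G. z $ v * net_current G (($) z) v)"
    using z dim_z
    by (simp add: scalar_prod_def rhs_vec_def atLeast0LessThan is_potential_def mult.commute)
  also have "\<dots> = dirichlet_energy G (($) z)"
    using valid by (intro sum_mult_net_current) (simp add: valid_network_def)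
  also have "\<dots> = dirichlet_energy G y" by (rule dirichlet_energy_cong[OF diff])
  finally have "rhs_vec G b \<bullet> z = dirichlet_energy G y" .
  with error show ?thesis by (simp add: laplacian_solution_def mat_norm_def z_def)
qed

lemma laplacian_solution_energy_le:
  assumes valid: "valid_network \<kappa> G" and potential: "is_potential G b y"
    and dim_x: "dim_vec x = nverts G"
    and solution: "laplacian_solution \<epsilon> G b x" and accuracy: "\<epsilon> \<le> 1/2"
  shows "dirichlet_energy G (\<lambda>v. x $ v - y v) \<le> dirichlet_energy G y / 4"
proof -
  have "sqrt (dirichlet_energy G (\<lambda>v. x $ v - y v)) \<le> \<epsilon> * sqrt (dirichlet_energy G y)"
    using solution laplacian_solution_iff[OF valid potential dim_x] by simp
  also have "\<dots> \<le> 1/2 * sqrt (dirichlet_energy G y)"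
    using accuracy dirichlet_energy_nonneg by (intro mult_right_mono) auto
  also have "\<dots> = sqrt (dirichlet_energy G y / 4)" by (simp add: real_sqrt_divide)
  finally show ?thesis by simp
qed

section \<open>Information flow into a shrinking region\<close>

definition crossing :: "network \<Rightarrow> (nat \<Rightarrow> nat set) \<Rightarrow> nat \<Rightarrow> (nat \<times> nat \<times> nat) set" where
  "crossing G R T = {(t, u, v). t < T \<and> adjacent G u v \<and> v \<in> R (Suc t) \<and> u \<notin> R t}"

definition transcript ::
  "algorithm \<Rightarrow> network \<Rightarrow> (nat \<Rightarrow> nat set) \<Rightarrow> (nat \<Rightarrow> coins) \<Rightarrow> nat \<Rightarrow> (nat \<Rightarrow> int)
    \<Rightarrow> nat \<times> nat \<times> nat \<Rightarrow> message" where
  "transcript A G R \<omega> T b = restrict (\<lambda>(t, u, v).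
     send A (local_of G b u) (\<omega> u) (hist A G b \<omega> t u) (ident G v)) (crossing G R T)"

lemma finite_crossing: "finite (crossing G R T)"
  by (rule finite_subset[of _ "{..<T} \<times> {..<nverts G} \<times> {..<nverts G}"])
    (auto simp: crossing_def adjacent_def)

lemma hist_eq_if_transcript_eq:
  assumes decseq: "decseq R"
    and agree: "\<And>v. v \<in> R 0 \<Longrightarrow> b v = b' v"
    and transcripts: "transcript A G R \<omega> T b = transcript A G R \<omega> T b'"
    and "t \<le> T" "v \<in> R t"
  shows "hist A G b \<omega> t v = hist A G b' \<omega> t v"
  using \<open>t \<le> T\<close> \<open>v \<in> R t\<close>
proof (induction t arbitrary: v)
  case (Suc t)
  have send: "send A (local_of G b u) (\<omega> u) (hist A G b \<omega> t u) (ident G v) =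
      send A (local_of G b' u) (\<omega> u) (hist A G b' \<omega> t u) (ident G v)" if "adjacent G u v" for u
  proof (cases "u \<in> R t")
    case True
    then have "b u = b' u" using decseqD[OF decseq, of 0 t] agree by auto
    then show ?thesis using Suc True by (simp add: local_of_def)
  next
    case False
    then have "(t, u, v) \<in> crossing G R T" using that Suc.prems by (simp add: crossing_def)
    then show ?thesis using fun_cong[OF transcripts, of "(t, u, v)"] by (simp add: transcript_def)
  qed
  have "hist A G b \<omega> t v = hist A G b' \<omega> t v" using Suc decseqD[OF decseq, of t "Suc t"] by auto
  then show ?case using send by (auto intro!: Collect_cong ex_cong1)
qed simp

lemma Least_cong_if_agree_upto:
  fixes N :: "'a :: wellorder"
  assumes agree: "\<And>k. k \<le> N \<Longrightarrow> P k \<longleftrightarrow> Q k" and witness: "\<exists>k\<le>N. P k"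
  shows "Least P = Least Q"
proof -
  obtain k where k: "k \<le> N" "P k" using witness by blast
  then have "Q k" using agree by blast
  have least_P: "P (Least P)" "Least P \<le> N"
    using k by (auto intro: LeastI Least_le order_trans)
  have least_Q: "Q (Least Q)" "Least Q \<le> N"
    using k(1) \<open>Q k\<close> by (auto intro: LeastI Least_le order_trans)
  show ?thesis using least_P least_Q agree by (intro antisym Least_le) auto
qed

lemma result_eq_if_transcript_eq:
  assumes decseq: "decseq R"
    and agree: "\<And>v. v \<in> R 0 \<Longrightarrow> b v = b' v"
    and transcripts: "transcript A G R \<omega> T b = transcript A G R \<omega> T b'"
    and v: "v \<in> R T" "v < nverts G"
    and finish: "finishes_within A G b \<omega> T"
  shows "result A G b \<omega> $ v = result A G b' \<omega> $ v"
proof -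
  let ?out = "\<lambda>b t. outp_at A G b \<omega> t v"
  have out: "?out b t = ?out b' t" if "t \<le> T" for t
  proof -
    have "v \<in> R t" "v \<in> R 0" using v decseqD[OF decseq that] decseqD[OF decseq, of 0 T] by auto
    then show ?thesis
      using hist_eq_if_transcript_eq[OF decseq agree transcripts that] agree
      by (simp add: outp_at_def local_of_def)
  qed
  have finish_v: "\<exists>t\<le>T. ?out b t \<noteq> None" using finish v by (simp add: finishes_within_def)
  then obtain t where t: "t \<le> T" "?out b t \<noteq> None" by blast
  have "(LEAST t. ?out b t \<noteq> None) \<le> T"
    using Least_le[of "\<lambda>t. ?out b t \<noteq> None", OF t(2)] t(1) by simp
  moreover have "(LEAST t. ?out b t \<noteq> None) = (LEAST t. ?out b' t \<noteq> None)"
    using out finish_v by (intro Least_cong_if_agree_upto[of T]) simp_all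
  ultimately show ?thesis using v out by (simp add: result_def)
qed

lemma dim_result: "dim_vec (result A G b \<omega>) = nverts G"
  by (simp add: result_def)

definition bandwidth :: "real \<Rightarrow> nat \<Rightarrow> nat" where
  "bandwidth \<beta> n = nat \<lfloor>\<beta> * log 2 (real n)\<rfloor>"

lemma length_send_le_bandwidth:
  assumes "congest \<beta> A"
  shows "length (send A l c h i) \<le> bandwidth \<beta> (net_size l)"
  using assms unfolding congest_def bandwidth_def by (intro le_nat_floor) blast

lemma card_short_messages: "card {xs :: message. length xs \<le> K} \<le> 2 ^ Suc K"
proof -
  have "card {xs :: message. length xs \<le> K} = (\<Sum>i\<le>K. 2 ^ i)"
    using card_lists_length_le[of "UNIV :: bool set" K] by simp
  also have "\<dots> = 2 ^ Suc K - 1"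
    using sum_power2[of "Suc K"] by (simp add: atLeast0LessThan lessThan_Suc_atMost)
  finally show ?thesis by simp
qed

lemma card_transcripts_le:
  assumes congest: "congest \<beta> A"
  shows "card (transcript A G R \<omega> T ` \<B>)
    \<le> 2 ^ (Suc (bandwidth \<beta> (nverts G)) * card (crossing G R T))"
proof -
  let ?K = "bandwidth \<beta> (nverts G)"
  let ?P = "crossing G R T \<rightarrow>\<^sub>E {xs :: message. length xs \<le> ?K}"
  have "length (send A (local_of G b u) (\<omega> u) h i) \<le> ?K" for b u h i
    using length_send_le_bandwidth[OF congest, of "local_of G b u"] by (simp add: local_of_def)
  then have "transcript A G R \<omega> T ` \<B> \<subseteq> ?P" by (auto simp: transcript_def PiE_iff)
  moreover have "finite ?P"
    using finite_crossing finite_lists_length_le[of "UNIV :: bool set" ?K]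
    by (intro finite_PiE) auto
  ultimately have "card (transcript A G R \<omega> T ` \<B>) \<le> card ?P" by (intro card_mono)
  also have "\<dots> = card {xs :: message. length xs \<le> ?K} ^ card (crossing G R T)"
    by (simp add: card_PiE finite_crossing)
  also have "\<dots> \<le> (2 ^ Suc ?K) ^ card (crossing G R T)"
    by (rule power_mono[OF card_short_messages]) simp
  finally show ?thesis by (simp only: power_mult)
qed

lemma (in prob_space) exists_point_in_many_events:
  assumes finite: "finite I" and events: "\<And>i. i \<in> I \<Longrightarrow> S i \<in> events"
    and likely: "\<And>i. i \<in> I \<Longrightarrow> p \<le> prob (S i)"
  shows "\<exists>\<omega>. p * card I \<le> card {i \<in> I. \<omega> \<in> S i}"
proof (rule ccontr)
  let ?X = "\<lambda>\<omega>. \<Sum>i\<in>I. indicator (S i) \<omega> :: real"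
  assume "\<nexists>\<omega>. p * card I \<le> card {i \<in> I. \<omega> \<in> S i}"
  moreover have "?X \<omega> = card {i \<in> I. \<omega> \<in> S i}" for \<omega>
    using finite by (simp add: indicator_def sum.If_cases Int_def)
  ultimately have "?X \<omega> < p * card I" for \<omega> by (simp add: not_le)
  moreover have integrable: "integrable M (indicator (S i) :: _ \<Rightarrow> real)" if "i \<in> I" for i
    using events[OF that] by (intro integrable_real_indicator) (simp_all add: emeasure_eq_measure)
  ultimately have "expectation ?X < p * card I" by (intro expectation_less) simp_all
  moreover have "expectation ?X = (\<Sum>i\<in>I. prob (S i))"
    using integrable events by (simp add: Bochner_Integration.integral_sum)
  moreover have "p * card I \<le> (\<Sum>i\<in>I. prob (S i))"
    using sum_bounded_below[of I p "\<lambda>i. prob (S i)"] likely by (simp add: mult.commute)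
  ultimately show False by simp
qed

lemma prob_space_coin_measure: "prob_space coin_measure"
  unfolding coin_measure_def by (intro prob_space_PiM measure_pmf.prob_space_axioms)

definition succeeds_within ::
  "real \<Rightarrow> algorithm \<Rightarrow> network \<Rightarrow> (nat \<Rightarrow> int) \<Rightarrow> (nat \<Rightarrow> coins) \<Rightarrow> nat \<Rightarrow> bool" where
  "succeeds_within \<epsilon> A G b \<omega> r \<longleftrightarrow>
     finishes_within A G b \<omega> r \<and> laplacian_solution \<epsilon> G b (result A G b \<omega>)"

lemma exists_coins_succeeding_often:
  assumes solves: "solves_laplacian_within \<kappa> \<epsilon> A T" and valid: "valid_network \<kappa> G"
    and finite: "finite I" and valid_rhs: "\<And>i. i \<in> I \<Longrightarrow> valid_rhs \<kappa> G (b i)"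
  shows "\<exists>\<omega>. 2/3 * card I
    \<le> card {i \<in> I. succeeds_within \<epsilon> A G (b i) \<omega> (T (nverts G) (diam G))}"
proof -
  let ?succeeds = "\<lambda>\<omega> i. succeeds_within \<epsilon> A G (b i) \<omega> (T (nverts G) (diam G))"
  interpret prob_space coin_measure by (rule prob_space_coin_measure)
  have "\<forall>i\<in>I. \<exists>S\<in>events. 2/3 \<le> prob S \<and> (\<forall>\<omega>\<in>S. ?succeeds \<omega> i)"
    using solves valid valid_rhs unfolding solves_laplacian_within_def succeeds_within_def by blast
  then obtain S where S: "\<And>i. i \<in> I \<Longrightarrow> S i \<in> events" "\<And>i. i \<in> I \<Longrightarrow> 2/3 \<le> prob (S i)"
    and succeeds: "\<And>i \<omega>. i \<in> I \<Longrightarrow> \<omega> \<in> S i \<Longrightarrow> ?succeeds \<omega> i"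
    by metis
  obtain \<omega> where "2/3 * card I \<le> card {i \<in> I. \<omega> \<in> S i}"
    using exists_point_in_many_events[of I S "2/3"] finite S by blast
  also have "card {i \<in> I. \<omega> \<in> S i} \<le> card {i \<in> I. ?succeeds \<omega> i}"
    using finite succeeds by (intro card_mono) auto
  finally show ?thesis by auto
qed

lemma card_le_card_image_mult:
  fixes V :: real
  assumes finite: "finite A" and fibre: "\<And>x. x \<in> A \<Longrightarrow> real (card {y \<in> A. f y = f x}) \<le> V"
  shows "real (card A) \<le> real (card (f ` A)) * V"
proof -
  have "real (card A) = (\<Sum>z\<in>f ` A. real (card {y \<in> A. f y = z}))"
    using sum.image_gen[OF finite, of "\<lambda>_. 1::nat" f] by simp
  also have "\<dots> \<le> (\<Sum>z\<in>f ` A. V)" using fibre by (intro sum_mono) auto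
  finally show ?thesis by simp
qed

definition consistent_rhs ::
  "real \<Rightarrow> network \<Rightarrow> ('i \<Rightarrow> nat \<Rightarrow> int) \<Rightarrow> nat set \<Rightarrow> real vec \<Rightarrow> 'i set" where
  "consistent_rhs \<epsilon> G b W x = {i. \<exists>x'. dim_vec x' = nverts G \<and>
     laplacian_solution \<epsilon> G (b i) x' \<and> (\<forall>v\<in>W. v < nverts G \<longrightarrow> x' $ v = x $ v)}"

text \<open>
  With the coins fixed, the output on the region is a function of the transcript, so each transcript
  accounts for at most \<open>V\<close> right-hand sides.
\<close>

lemma transcript_counting_bound:
  assumes congest: "congest \<beta> A" and solves: "solves_laplacian_within \<kappa> \<epsilon> A T"
    and valid: "valid_network \<kappa> G"
    and finite: "finite I" and valid_rhs: "\<And>i. i \<in> I \<Longrightarrow> valid_rhs \<kappa> G (b i)"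
    and decseq: "decseq R"
    and agree: "\<And>i j v. i \<in> I \<Longrightarrow> j \<in> I \<Longrightarrow> v \<in> R 0 \<Longrightarrow> b i v = b j v"
    and rounds: "r = T (nverts G) (diam G)"
    and few: "\<And>x. real (card (I \<inter> consistent_rhs \<epsilon> G b (R r) x)) \<le> V"
  shows "2/3 * real (card I)
    \<le> 2 ^ (Suc (bandwidth \<beta> (nverts G)) * card (crossing G R r)) * V"
proof -
  obtain \<omega> where \<omega>: "2/3 * card I \<le> card {i \<in> I. succeeds_within \<epsilon> A G (b i) \<omega> r}"
    using exists_coins_succeeding_often[OF solves valid finite, of b] valid_rhs
    unfolding rounds by blast
  define good where "good = {i \<in> I. succeeds_within \<epsilon> A G (b i) \<omega> r}"
  define tr where "tr i = transcript A G R \<omega> r (b i)" for i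
  have fibre: "real (card {j \<in> good. tr j = tr i}) \<le> V" if i: "i \<in> good" for i
  proof -
    let ?C = "I \<inter> consistent_rhs \<epsilon> G b (R r) (result A G (b i) \<omega>)"
    have "result A G (b j) \<omega> $ v = result A G (b i) \<omega> $ v"
      if "j \<in> good" "tr j = tr i" "v \<in> R r" "v < nverts G" for j v
      using that i decseq agree unfolding good_def tr_def succeeds_within_def
      by (intro result_eq_if_transcript_eq[of R]) auto
    then have "{j \<in> good. tr j = tr i} \<subseteq> ?C"
      by (auto simp: good_def succeeds_within_def consistent_rhs_def intro: dim_result)
    then have "card {j \<in> good. tr j = tr i} \<le> card ?C" using finite by (intro card_mono) auto
    then show ?thesis using few[of "result A G (b i) \<omega>"] by linarith
  qed
  have nonneg: "0 \<le> V" using of_nat_0_le_iff few by (rule order_trans)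
  have "card (tr ` good) \<le> 2 ^ (Suc (bandwidth \<beta> (nverts G)) * card (crossing G R r))"
    using card_transcripts_le[OF congest, of G R \<omega> r "b ` good"] by (simp add: tr_def image_image)
  then have transcripts: "real (card (tr ` good))
      \<le> 2 ^ (Suc (bandwidth \<beta> (nverts G)) * card (crossing G R r))"
    by (simp flip: of_nat_le_iff)
  have "2/3 * real (card I) \<le> real (card good)" using \<omega> by (simp add: good_def)
  also have "\<dots> \<le> real (card (tr ` good)) * V"
    using finite fibre by (intro card_le_card_image_mult) (auto simp: good_def)
  also have "\<dots> \<le> 2 ^ (Suc (bandwidth \<beta> (nverts G)) * card (crossing G R r)) * V"
    using transcripts nonneg by (rule mult_right_mono)
  finally show ?thesis .
qed

section \<open>Networks with labelled vertices\<close>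

lemma relpow_map:
  assumes "\<And>a c. (a, c) \<in> E \<Longrightarrow> (f a, f c) \<in> E'"
  shows "(a, c) \<in> E ^^ k \<Longrightarrow> (f a, f c) \<in> E' ^^ k"
proof (induction k arbitrary: c)
  case (Suc k)
  then obtain d where "(a, d) \<in> E ^^ k" "(d, c) \<in> E" by auto
  then show ?case using Suc.IH assms by (blast intro: relpow_Suc_I)
qed simp

lemma relpow_sym: "sym E \<Longrightarrow> (u, v) \<in> E ^^ k \<Longrightarrow> (v, u) \<in> E ^^ k"
proof (induction k arbitrary: v)
  case (Suc k)
  then obtain w where "(u, w) \<in> E ^^ k" "(w, v) \<in> E" by auto
  with Suc show ?case by (meson relpow_Suc_I2 symD)
qed simp

lemma relpow_lipschitz:
  fixes \<phi> :: "'a \<Rightarrow> int"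
  assumes lipschitz: "\<And>u v. (u, v) \<in> E \<Longrightarrow> \<bar>\<phi> u - \<phi> v\<bar> \<le> 1"
  shows "(u, v) \<in> E ^^ k \<Longrightarrow> \<bar>\<phi> u - \<phi> v\<bar> \<le> int k"
proof (induction k arbitrary: v)
  case (Suc k)
  then obtain w where w: "(u, w) \<in> E ^^ k" "(w, v) \<in> E" by auto
  with Suc.IH[OF w(1)] lipschitz[OF w(2)] show ?case by simp
qed simp

lemma diam_eqI:
  fixes \<phi> :: "nat \<Rightarrow> int"
  assumes reach: "\<And>u v. u < nverts G \<Longrightarrow> v < nverts G \<Longrightarrow> \<exists>k\<le>D. (u, v) \<in> edge_rel G ^^ k"
    and lipschitz: "\<And>u v. (u, v) \<in> edge_rel G \<Longrightarrow> \<bar>\<phi> u - \<phi> v\<bar> \<le> 1"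
    and far: "u < nverts G" "v < nverts G" "\<phi> v - \<phi> u = int D"
  shows "diam G = D"
proof -
  have hop_dist_le: "hop_dist G a c \<le> D" if "a < nverts G" "c < nverts G" for a c
    unfolding hop_dist_def using reach[OF that] by (meson Least_le order_trans)
  obtain k where "(u, v) \<in> edge_rel G ^^ k" using reach far by blast
  then have "(u, v) \<in> edge_rel G ^^ hop_dist G u v" unfolding hop_dist_def by (rule LeastI)
  with lipschitz have "\<bar>\<phi> u - \<phi> v\<bar> \<le> int (hop_dist G u v)" by (rule relpow_lipschitz)
  then have "hop_dist G u v = D" using hop_dist_le far by (simp add: antisym)
  then show ?thesis unfolding diam_def
    using hop_dist_le far finite_image_set2[of "\<lambda>u. u < nverts G" "\<lambda>v. v < nverts G" "hop_dist G"]
    by (intro Max_eqI) auto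
qed

text \<open>
  Each edge of the network is listed by \<open>w\<close> in one of its orientations, the one in which the
  current will flow.
\<close>

locale labelled_network =
  fixes n :: nat and label :: "nat \<Rightarrow> 'a" and V :: "'a set" and w :: "'a \<Rightarrow> 'a \<Rightarrow> nat"
  assumes label: "bij_betw label {..<n} V"
begin

definition index :: "'a \<Rightarrow> nat" where
  "index = inv_into {..<n} label"

definition net :: network where
  "net = \<lparr>nverts = n, ident = id, wt = (\<lambda>u v. w (label u) (label v) + w (label v) (label u))\<rparr>"

definition link :: "('a \<times> 'a) set" where
  "link = {(a, c). a \<in> V \<and> c \<in> V \<and> 0 < w a c + w c a}"

definition out_current :: "('a \<Rightarrow> real) \<Rightarrow> 'a \<Rightarrow> real" where
  "out_current f a = (\<Sum>c\<in>V. real (w a c) * (f a - f c))"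

definition in_current :: "('a \<Rightarrow> real) \<Rightarrow> 'a \<Rightarrow> real" where
  "in_current f a = (\<Sum>c\<in>V. real (w c a) * (f c - f a))"

definition energy :: "('a \<Rightarrow> real) \<Rightarrow> real" where
  "energy f = (\<Sum>a\<in>V. \<Sum>c\<in>V. real (w a c) * (f a - f c)\<^sup>2)"

definition drives :: "('a \<Rightarrow> real) \<Rightarrow> ('a \<Rightarrow> int) \<Rightarrow> bool" where
  "drives y b \<longleftrightarrow> (\<forall>a\<in>V. out_current y a - in_current y a = real_of_int (b a))"

lemma net_simps [simp]:
  "nverts net = n" "ident net = id"
  "wt net u v = w (label u) (label v) + w (label v) (label u)"
  by (simp_all add: net_def)

lemma finite_V: "finite V"
  using bij_betw_finite[OF label] by simp

lemma label_in_V [simp]: "v < n \<Longrightarrow> label v \<in> V"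
  using label by (auto simp: bij_betw_def)

lemma label_index [simp]: "a \<in> V \<Longrightarrow> label (index a) = a"
  using bij_betw_inv_into_right[OF label] by (simp add: index_def)

lemma index_label [simp]: "v < n \<Longrightarrow> index (label v) = v"
  using bij_betw_inv_into_left[OF label] by (simp add: index_def)

lemma index_less [simp]: "a \<in> V \<Longrightarrow> index a < n"
  using bij_betw_inv_into[OF label] by (auto simp: index_def bij_betw_def)

lemma sum_label: "(\<Sum>v<n. f (label v)) = (\<Sum>a\<in>V. f a)"
  by (rule sum.reindex_bij_betw[OF label])

lemma sym_link: "sym link"
  by (auto simp: sym_def link_def)

lemma edge_rel_net_iff: "(u, v) \<in> edge_rel net \<longleftrightarrow> u < n \<and> v < n \<and> (label u, label v) \<in> link"
  by (auto simp: edge_rel_def adjacent_def link_def)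

lemma relpow_link_imp_edge_rel:
  assumes "u < n" "v < n" "(label u, label v) \<in> link ^^ k"
  shows "(u, v) \<in> edge_rel net ^^ k"
proof -
  have "(index (label u), index (label v)) \<in> edge_rel net ^^ k"
    using assms(3) by (rule relpow_map[rotated]) (auto simp: edge_rel_net_iff link_def)
  then show ?thesis using assms by simp
qed

lemma diam_net:
  fixes \<phi> :: "'a \<Rightarrow> int"
  assumes reach: "\<And>a c. a \<in> V \<Longrightarrow> c \<in> V \<Longrightarrow> \<exists>k\<le>D. (a, c) \<in> link ^^ k"
    and lipschitz: "\<And>a c. a \<in> V \<Longrightarrow> c \<in> V \<Longrightarrow> 0 < w a c \<Longrightarrow> \<bar>\<phi> a - \<phi> c\<bar> \<le> 1"
    and far: "a \<in> V" "c \<in> V" "\<phi> c - \<phi> a = int D"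
  shows "diam net = D"
proof (rule diam_eqI[where \<phi> = "\<phi> \<circ> label" and u = "index a" and v = "index c"])
  show "\<exists>k\<le>D. (u, v) \<in> edge_rel net ^^ k" if "u < nverts net" "v < nverts net" for u v
    using reach[of "label u" "label v"] relpow_link_imp_edge_rel that by auto
  show "\<bar>(\<phi> \<circ> label) u - (\<phi> \<circ> label) v\<bar> \<le> 1" if "(u, v) \<in> edge_rel net" for u v
    using that lipschitz[of "label u" "label v"] lipschitz[of "label v" "label u"]
    by (auto simp: edge_rel_net_iff link_def abs_minus_commute)
qed (use far in simp_all)

lemma valid_net:
  assumes "0 < n" "1 \<le> \<kappa>"
    and connected: "\<And>a c. a \<in> V \<Longrightarrow> c \<in> V \<Longrightarrow> (a, c) \<in> link\<^sup>*"
    and loop_free: "\<And>a. w a a = 0"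
    and bounded: "\<And>a c. a \<in> V \<Longrightarrow> c \<in> V \<Longrightarrow> w a c + w c a \<le> n ^ \<kappa>"
  shows "valid_network \<kappa> net"
proof -
  have "n \<le> n ^ \<kappa>" using assms(1,2) by (intro self_le_power) auto
  then have "v < n ^ \<kappa>" if "v < n" for v using that by simp
  moreover have "(u, v) \<in> (edge_rel net)\<^sup>*" if "u < n" "v < n" for u v
    using connected[of "label u" "label v"] relpow_link_imp_edge_rel that
    by (auto simp: rtrancl_power)
  ultimately show ?thesis
    using assms(1) loop_free bounded by (simp add: valid_network_def add.commute)
qed

lemma net_current_net:
  assumes "v < n"
  shows "net_current net (f \<circ> label) v = out_current f (label v) - in_current f (label v)"
proof -
  have "net_current net (f \<circ> label) v = (\<Sum>u<n.
      real (w (label v) (label u)) * (f (label v) - f (label u))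
      - real (w (label u) (label v)) * (f (label u) - f (label v)))"
    by (simp add: net_current_def algebra_simps)
  also have "\<dots> = (\<Sum>c\<in>V. real (w (label v) c) * (f (label v) - f c)
      - real (w c (label v)) * (f c - f (label v)))"
    by (rule sum_label)
  finally show ?thesis by (simp add: out_current_def in_current_def sum_subtractf)
qed

lemma dirichlet_energy_net: "dirichlet_energy net (f \<circ> label) = energy f"
proof -
  let ?e = "\<lambda>a c. real (w a c) * (f a - f c)\<^sup>2"
  have "2 * dirichlet_energy net (f \<circ> label)
      = (\<Sum>u<n. \<Sum>v<n. ?e (label u) (label v) + ?e (label v) (label u))"
    by (simp add: dirichlet_energy_def algebra_simps power2_commute)
  also have "\<dots> = (\<Sum>a\<in>V. \<Sum>c\<in>V. ?e a c + ?e c a)"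
    unfolding sum_label[of "\<lambda>c. ?e (label _) c + ?e c (label _)"] by (rule sum_label)
  also have "\<dots> = energy f + (\<Sum>a\<in>V. \<Sum>c\<in>V. ?e c a)"
    by (simp add: energy_def sum.distrib)
  also have "(\<Sum>a\<in>V. \<Sum>c\<in>V. ?e c a) = energy f"
    unfolding energy_def by (rule sum.swap)
  finally show ?thesis by (simp add: comp_def)
qed

lemma is_potential_net: "drives y b \<Longrightarrow> is_potential net (b \<circ> label) (y \<circ> label)"
  by (simp add: is_potential_def drives_def net_current_net)

lemma energy_if_drives:
  assumes "drives y b"
  shows "energy y = (\<Sum>a\<in>V. y a * real_of_int (b a))"
proof -
  have "energy y = (\<Sum>v<n. y (label v) * net_current net (y \<circ> label) v)"
    using sum_mult_net_current[of net "y \<circ> label"] by (simp add: dirichlet_energy_net)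
  also have "\<dots> = (\<Sum>v<n. y (label v) * real_of_int (b (label v)))"
    using is_potential_net[OF assms] by (simp add: is_potential_def)
  finally show ?thesis using sum_label[of "\<lambda>a. y a * real_of_int (b a)"] by simp
qed

lemma solution_error_energy_le:
  assumes valid: "valid_network \<kappa> net" and drives: "drives y b" and dim_x: "dim_vec x = n"
    and solution: "laplacian_solution \<epsilon> net (b \<circ> label) x" and accuracy: "\<epsilon> \<le> 1/2"
  shows "energy (\<lambda>a. x $ index a - y a) \<le> energy y / 4"
proof -
  have "dirichlet_energy net (\<lambda>v. x $ v - (y \<circ> label) v) \<le> energy y / 4"
    using laplacian_solution_energy_le[OF valid is_potential_net[OF drives] _ solution accuracy]
      dim_x
    by (simp add: dirichlet_energy_net)
  moreover have "dirichlet_energy net (\<lambda>v. x $ v - (y \<circ> label) v)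
      = dirichlet_energy net ((\<lambda>a. x $ index a - y a) \<circ> label)"
    by (rule dirichlet_energy_cong) simp
  ultimately show ?thesis by (simp add: dirichlet_energy_net)
qed

lemma sum_edges_le_energy:
  assumes "P \<subseteq> V \<times> V"
  shows "(\<Sum>(a, c)\<in>P. real (w a c) * (f a - f c)\<^sup>2) \<le> energy f"
  unfolding energy_def sum.cartesian_product
  using assms finite_V by (intro sum_mono2) auto

abbreviation consistent_demands ::
  "real \<Rightarrow> ('i \<Rightarrow> 'a \<Rightarrow> int) \<Rightarrow> 'a set \<Rightarrow> real vec \<Rightarrow> 'i set" where
  "consistent_demands \<epsilon> b U x \<equiv> consistent_rhs \<epsilon> net (\<lambda>i. b i \<circ> label) (label -` U) x"

text \<open>
  The triangle inequality: along \<open>P\<close>, both potentials have approximately the drops of the output.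
\<close>

lemma consistent_demands_separation:
  assumes valid: "valid_network \<kappa> net" and accuracy: "\<epsilon> \<le> 1/2"
    and drives: "drives (y i) (b i)" "drives (y j) (b j)"
    and consistent: "i \<in> consistent_demands \<epsilon> b U x" "j \<in> consistent_demands \<epsilon> b U x"
    and P: "P \<subseteq> (V \<inter> U) \<times> (V \<inter> U)"
  shows "(\<Sum>(a, c)\<in>P. real (w a c) * ((y i a - y i c) - (y j a - y j c))\<^sup>2)
    \<le> (energy (y i) + energy (y j)) / 2"
proof -
  obtain xi xj where xi: "dim_vec xi = n" "laplacian_solution \<epsilon> net (b i \<circ> label) xi"
    and xj: "dim_vec xj = n" "laplacian_solution \<epsilon> net (b j \<circ> label) xj"
    and outputs_agree: "\<And>v. label v \<in> U \<Longrightarrow> v < n \<Longrightarrow> xi $ v = x $ v \<and> xj $ v = x $ v"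
    using consistent by (auto simp: consistent_rhs_def)
  define ei where "ei = (\<lambda>a. xi $ index a - y i a)"
  define ej where "ej = (\<lambda>a. xj $ index a - y j a)"
  have drops: "(y i a - y i c) - (y j a - y j c) = (ej a - ej c) - (ei a - ei c)"
    if "(a, c) \<in> P" for a c
    using that P outputs_agree[of "index a"] outputs_agree[of "index c"]
    by (auto simp: ei_def ej_def)
  have parallelogram: "(p - q)\<^sup>2 \<le> 2 * p\<^sup>2 + 2 * q\<^sup>2" for p q :: real
    using zero_le_power2[of "p + q"] by (simp add: power2_eq_square algebra_simps)
  have "(\<Sum>(a, c)\<in>P. real (w a c) * ((y i a - y i c) - (y j a - y j c))\<^sup>2)
      \<le> (\<Sum>(a, c)\<in>P. real (w a c) * (2 * (ej a - ej c)\<^sup>2 + 2 * (ei a - ei c)\<^sup>2))"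
    by (rule sum_mono) (auto simp: drops intro!: mult_left_mono parallelogram)
  also have "\<dots> = 2 * (\<Sum>(a, c)\<in>P. real (w a c) * (ej a - ej c)\<^sup>2)
      + 2 * (\<Sum>(a, c)\<in>P. real (w a c) * (ei a - ei c)\<^sup>2)"
    by (simp add: sum.distrib sum_distrib_left distrib_left mult.left_commute split_def)
  also have "\<dots> \<le> 2 * energy ej + 2 * energy ei"
    using P by (intro add_mono mult_left_mono sum_edges_le_energy) auto
  also have "\<dots> \<le> 2 * (energy (y j) / 4) + 2 * (energy (y i) / 4)"
    unfolding ei_def ej_def using solution_error_energy_le[OF valid drives(1) xi accuracy]
      solution_error_energy_le[OF valid drives(2) xj accuracy]
    by simp
  finally show ?thesis by simp
qed

definition link_crossing :: "(nat \<Rightarrow> 'a set) \<Rightarrow> nat \<Rightarrow> (nat \<times> 'a \<times> 'a) set" where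
  "link_crossing U T = {(t, a, c). t < T \<and> (a, c) \<in> link \<and> c \<in> U (Suc t) \<and> a \<notin> U t}"

lemma finite_link_crossing: "finite (link_crossing U T)"
  by (rule finite_subset[of _ "{..<T} \<times> V \<times> V"]) (auto simp: link_crossing_def link_def finite_V)

lemma card_crossing_net_le: "card (crossing net (\<lambda>t. label -` U t) T) \<le> card (link_crossing U T)"
proof (rule card_inj_on_le)
  show "inj_on (map_prod id (map_prod label label)) (crossing net (\<lambda>t. label -` U t) T)"
    by (auto simp: crossing_def adjacent_def intro!: inj_onI
        dest!: inj_onD[OF bij_betw_imp_inj_on[OF label]])
  show "map_prod id (map_prod label label) ` crossing net (\<lambda>t. label -` U t) T
      \<subseteq> link_crossing U T"
    by (auto simp: crossing_def adjacent_def link_crossing_def link_def)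
qed (rule finite_link_crossing)

lemma link_crossing_counting_bound:
  assumes congest: "congest \<beta> A" and solves: "solves_laplacian_within \<kappa> \<epsilon> A T"
    and valid: "valid_network \<kappa> net"
    and finite: "finite I" and valid_rhs: "\<And>i. i \<in> I \<Longrightarrow> valid_rhs \<kappa> net (b i \<circ> label)"
    and decseq: "decseq U"
    and agree: "\<And>i j a. i \<in> I \<Longrightarrow> j \<in> I \<Longrightarrow> a \<in> U 0 \<Longrightarrow> b i a = b j a"
    and rounds: "r = T n (diam net)" and crossing: "card (link_crossing U r) \<le> N"
    and few: "\<And>x. real (card (I \<inter> consistent_demands \<epsilon> b (U r) x)) \<le> M"
  shows "2/3 * real (card I) \<le> 2 ^ (Suc (bandwidth \<beta> n) * N) * M"
proof -
  let ?R = "\<lambda>t. label -` U t"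
  have "2/3 * real (card I) \<le> 2 ^ (Suc (bandwidth \<beta> n) * card (crossing net ?R r)) * M"
  proof (rule transcript_counting_bound[OF congest solves valid, unfolded net_simps,
        where b = "\<lambda>i. b i \<circ> label"])
    show "decseq ?R" using decseq by (auto simp: decseq_def)
    show "(b i \<circ> label) v = (b j \<circ> label) v" if "i \<in> I" "j \<in> I" "v \<in> ?R 0" for i j v
      using agree[OF that(1,2)] that(3) by simp
  qed (use finite valid_rhs rounds few in simp_all)
  also have "\<dots> \<le> 2 ^ (Suc (bandwidth \<beta> n) * N) * M"
  proof (intro mult_right_mono power_increasing mult_le_mono2)
    show "card (crossing net ?R r) \<le> N"
      using card_crossing_net_le crossing by (rule order_trans)
    show "0 \<le> M" using of_nat_0_le_iff few by (rule order_trans)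
  qed simp
  finally show ?thesis .
qed

end

section \<open>The path network\<close>

text \<open>
  A path \<open>0, \<dots>, D\<close> whose middle edge is light, so that it carries half of the energy of a flow
  between the two ends; the vertices beyond \<open>D\<close> are pendants that bring the order up to \<open>n\<close>.
\<close>

definition path_edge :: "nat \<Rightarrow> nat \<Rightarrow> nat \<Rightarrow> nat" where
  "path_edge D u v =
     (if v = Suc u \<and> v \<le> D then (if u = D div 2 then 1 else D) else if u = 1 \<and> v > D then 1 else 0)"

locale path_network =
  fixes n D :: nat
  assumes length_bounds: "2 \<le> D" "D < n"

sublocale path_network \<subseteq> labelled_network n id "{..<n}" "path_edge D"
  by unfold_locales simp

context path_network
begin

definition position :: "nat \<Rightarrow> nat" where
  "position v = (if v \<le> D then v else 0)"

lemma walk_forward: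
  assumes "u < n" "position u \<le> v" "1 \<le> v" "v \<le> D"
  shows "(u, v) \<in> link ^^ (v - position u)"
  using assms
proof (induction v)
  case (Suc v)
  consider (arrived) "position u = Suc v" | (step) "position u \<le> v" "1 \<le> v"
    | (first_step) "position u = 0" "v = 0"
    using Suc.prems by linarith
  then show ?case
  proof cases
    case arrived
    then show ?thesis by (simp add: position_def split: if_splits)
  next
    case step
    then have "(u, v) \<in> link ^^ (v - position u)" using Suc by simp
    moreover have "(v, Suc v) \<in> link"
      using Suc.prems length_bounds by (auto simp: link_def path_edge_def)
    ultimately show ?thesis using step by (auto simp: Suc_diff_le)
  next
    case first_step
    then have "(u, 1) \<in> link"
      using Suc.prems length_bounds
      by (auto simp: link_def path_edge_def position_def split: if_splits)
    then show ?thesis using first_step by simp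
  qed
qed simp

lemma exists_short_walk:
  assumes "u < n" "v < n"
  shows "\<exists>k\<le>D. (u, v) \<in> link ^^ k"
proof -
  have forward: "\<exists>k\<le>D. (a, c) \<in> link ^^ k" if "a < n" "c < n" "position a \<le> position c" for a c
  proof (cases "position c = 0")
    case True
    have "(a, 1) \<in> link ^^ 1" "(c, 1) \<in> link ^^ 1"
      using walk_forward[of a 1] walk_forward[of c 1] that length_bounds True by simp_all
    then have "(a, c) \<in> link ^^ (1 + 1)" by (rule relpow_trans[OF _ relpow_sym[OF sym_link]])
    then show ?thesis using length_bounds by (intro exI[of _ "1 + 1"]) simp
  next
    case False
    then have "position c = c" "c \<le> D" by (auto simp: position_def split: if_splits)
    then show ?thesis
      using walk_forward[of a c] that False by (intro exI[of _ "c - position a"]) auto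
  qed
  show ?thesis
    using forward[OF assms] forward[OF assms(2,1)] relpow_sym[OF sym_link]
    by (cases "position u \<le> position v") auto
qed

lemma diam_path_network: "diam net = D"
proof (rule diam_net[where \<phi> = "int \<circ> position" and a = 0 and c = D])
  show "\<bar>(int \<circ> position) a - (int \<circ> position) c\<bar> \<le> 1" if "0 < path_edge D a c" for a c
    using that by (auto simp: path_edge_def position_def split: if_splits)
qed (use exists_short_walk length_bounds in \<open>auto simp: position_def\<close>)

lemma valid_path_network:
  assumes "1 \<le> \<kappa>"
  shows "valid_network \<kappa> net"
proof (rule valid_net)
  show "path_edge D a c + path_edge D c a \<le> n ^ \<kappa>" for a c
  proof -
    have "path_edge D a c + path_edge D c a \<le> D" using length_bounds by (auto simp: path_edge_def)
    also have "\<dots> \<le> n" using length_bounds by simp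
    also have "\<dots> \<le> n ^ \<kappa>" using length_bounds assms by (intro self_le_power) auto
    finally show ?thesis .
  qed
  show "(a, c) \<in> link\<^sup>*" if "a \<in> {..<n}" "c \<in> {..<n}" for a c
    using exists_short_walk[of a c] that by (auto simp: rtrancl_power)
qed (use length_bounds assms in \<open>auto simp: path_edge_def\<close>)

definition potential :: "int \<Rightarrow> nat \<Rightarrow> real" where
  "potential s v = s *
     (if v > D then 2 * real D - 2 else if v \<le> D div 2 then 2 * real D - 1 - v else real D - v)"

definition demand :: "int \<Rightarrow> nat \<Rightarrow> int" where
  "demand s v = (if v = 0 then s * int D else if v = D then - s * int D else 0)"

lemma valid_demand:
  assumes "1 \<le> \<kappa>" "\<bar>s\<bar> \<le> 1"
  shows "valid_rhs \<kappa> net (demand s)"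
proof -
  have "\<bar>demand s v\<bar> \<le> int n ^ \<kappa>" for v
  proof -
    have "\<bar>demand s v\<bar> \<le> int D"
      using mult_right_mono[OF assms(2), of "int D"] by (simp add: demand_def abs_mult)
    also have "\<dots> \<le> int n" using length_bounds by simp
    also have "\<dots> \<le> int n ^ \<kappa>" using length_bounds assms(1) by (intro self_le_power) auto
    finally show ?thesis .
  qed
  then show ?thesis by (simp add: valid_rhs_def)
qed

lemma current_potential:
  "real (path_edge D v u) * (potential s v - potential s u)
    = (if u = Suc v \<and> v < D then s * real D else 0)"
  using length_bounds by (auto simp: path_edge_def potential_def algebra_simps)

lemma drives_potential: "drives (potential s) (demand s)"
  unfolding drives_def
proof
  fix v assume v: "v \<in> {..<n}"
  have "out_current (potential s) v = (if v < D then s * real D else 0)"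
    using length_bounds by (auto simp: out_current_def current_potential)
  moreover have "in_current (potential s) v
      = (\<Sum>u<n. if u = v - 1 then (if 0 < v \<and> v \<le> D then s * real D else 0) else 0)"
    unfolding in_current_def current_potential by (intro sum.cong) auto
  then have "in_current (potential s) v = (if 0 < v \<and> v \<le> D then s * real D else 0)"
    using v by (auto simp: sum.delta)
  ultimately show "out_current (potential s) v - in_current (potential s) v = demand s v"
    using length_bounds by (auto simp: demand_def)
qed

lemma energy_potential: "energy (potential s) = (real_of_int s)\<^sup>2 * (real D * (2 * real D - 1))"
proof -
  have "energy (potential s) = (\<Sum>v<n. potential s v * real_of_int (demand s v))"
    by (rule energy_if_drives[OF drives_potential])
  also have "\<dots> = (\<Sum>v\<in>{0, D}. potential s v * real_of_int (demand s v))"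
    using length_bounds by (intro sum.mono_neutral_right) (auto simp: demand_def)
  also have "\<dots> = (real_of_int s)\<^sup>2 * (real D * (2 * real D - 1))"
    using length_bounds by (auto simp: demand_def potential_def power2_eq_square)
  finally show ?thesis .
qed

definition far_from_ends :: "nat \<Rightarrow> nat set" where
  "far_from_ends t = {v. t < v \<and> v + t < D}"

lemma link_crossing_far_from_ends: "link_crossing far_from_ends T = {}"
  by (auto simp: link_crossing_def link_def far_from_ends_def path_edge_def split: if_splits)

lemma not_both_signs_consistent:
  fixes \<kappa> :: nat
  assumes exponent: "1 \<le> \<kappa>" and accuracy: "\<epsilon> \<le> 1/2" and early: "Suc r < D div 2"
    and consistent: "1 \<in> consistent_demands \<epsilon> demand (far_from_ends r) x"
      "- 1 \<in> consistent_demands \<epsilon> demand (far_from_ends r) x"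
  shows False
proof -
  let ?middle = "(D div 2, Suc (D div 2))"
  have "{?middle} \<subseteq> ({..<n} \<inter> far_from_ends r) \<times> ({..<n} \<inter> far_from_ends r)"
    using early length_bounds by (auto simp: far_from_ends_def)
  from consistent_demands_separation[OF valid_path_network[OF exponent] accuracy
      drives_potential drives_potential consistent this]
  have "real (path_edge D (D div 2) (Suc (D div 2)))
      * ((potential 1 (D div 2) - potential 1 (Suc (D div 2)))
        - (potential (- 1) (D div 2) - potential (- 1) (Suc (D div 2))))\<^sup>2
      \<le> (energy (potential 1) + energy (potential (- 1))) / 2" by simp
  moreover have "potential s (D div 2) - potential s (Suc (D div 2)) = s * real D" for s
    using length_bounds by (simp add: potential_def algebra_simps)
  moreover have "path_edge D (D div 2) (Suc (D div 2)) = 1"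
    using length_bounds by (simp add: path_edge_def)
  ultimately have "(2 * real D)\<^sup>2 \<le> real D * (2 * real D - 1)"
    by (simp add: energy_potential)
  also have "\<dots> < real D * (4 * real D)" using length_bounds by (intro mult_strict_left_mono) auto
  finally show False by (simp add: power2_eq_square)
qed

lemma rounds_ge_half_length:
  assumes congest: "congest \<beta> A" and solves: "solves_laplacian_within \<kappa> \<epsilon> A T"
    and exponent: "1 \<le> \<kappa>" and accuracy: "\<epsilon> \<le> 1/2"
  shows "D div 2 \<le> T n D + 1"
proof (rule ccontr)
  let ?I = "{1, -1 :: int}"
  let ?C = "consistent_demands \<epsilon> demand (far_from_ends (T n D))"
  assume short: "\<not> D div 2 \<le> T n D + 1"
  have "card (?I \<inter> ?C x) \<le> 1" for x
  proof -
    have "\<not> ?I \<subseteq> ?C x"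
      using not_both_signs_consistent[OF exponent accuracy, of "T n D" x] short by auto
    then have "?I \<inter> ?C x \<subset> ?I" by blast
    from psubset_card_mono[OF _ this] show ?thesis by simp
  qed
  then have "2/3 * real (card ?I) \<le> 2 ^ (Suc (bandwidth \<beta> n) * 0) * 1"
    by (intro link_crossing_counting_bound[OF congest solves valid_path_network[OF exponent],
          of _ demand far_from_ends "T n D"])
      (auto simp: valid_demand[OF exponent] decseq_def far_from_ends_def demand_def
        diam_path_network link_crossing_far_from_ends)
  then show False by simp
qed

end

section \<open>The highway network and its flow\<close>

text \<open>
  \<open>Row \<sigma> i j\<close> is the vertex in column \<open>j\<close> of one of the two rows of the \<open>i\<close>-th pair, and
  \<open>Tree e k\<close> is the \<open>k\<close>-th vertex at height \<open>e\<close> above the leaves.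
\<close>

datatype vertex = Row bool nat nat | Tree nat nat | Tail nat | Pendant nat

definition rung :: "nat \<Rightarrow> nat \<Rightarrow> nat" where
  "rung h j = (if Suc j = 2 ^ h then 10 * 2 ^ h else 1)"

definition row_potential :: "nat \<Rightarrow> nat \<Rightarrow> nat" where
  "row_potential h j = 10 * 2 ^ h + (2 ^ h - 1 - j)"

text \<open>
  The potential falls by 1 along every row edge, so by flow conservation the weight of the row edge
  into column \<open>j\<close> has to be the total current that leaves the row in the columns \<open>\<ge> j\<close>.
\<close>

definition row_flow :: "nat \<Rightarrow> nat \<Rightarrow> nat" where
  "row_flow h j = (\<Sum>k\<in>{j..<2 ^ h}. rung h k * row_potential h k)"

fun highway_edge :: "nat \<Rightarrow> vertex \<Rightarrow> vertex \<Rightarrow> nat" where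
  "highway_edge h (Row \<sigma> i j) (Row \<sigma>' i' j') =
     (if \<sigma>' = \<sigma> \<and> i' = i \<and> j' = Suc j then row_flow h (Suc j) else 0)"
| "highway_edge h (Row \<sigma> i j) (Tree e k) = (if e = 0 \<and> k = j then rung h j else 0)"
| "highway_edge h (Tree e k) (Tree e' k') = (if e' = Suc e \<and> k' = k div 2 then 1 else 0)"
| "highway_edge h (Tree e k) (Tail q) = (if e = h \<and> q = 0 then 1 else 0)"
| "highway_edge h (Tree e k) (Pendant q) = (if e = h then 1 else 0)"
| "highway_edge h (Tail q) (Tail q') = (if q' = Suc q then 1 else 0)"
| "highway_edge h _ _ = 0"

definition core_vertices :: "nat \<Rightarrow> nat \<Rightarrow> nat \<Rightarrow> vertex set" where
  "core_vertices h m Q = (\<lambda>(\<sigma>, i, j). Row \<sigma> i j) ` (UNIV \<times> {..<m} \<times> {..<2 ^ h})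
     \<union> (\<lambda>(e, k). Tree e k) ` (SIGMA e:{..h}. {..<2 ^ (h - e)}) \<union> Tail ` {..<Q}"

definition highway_vertices :: "nat \<Rightarrow> nat \<Rightarrow> nat \<Rightarrow> nat \<Rightarrow> vertex set" where
  "highway_vertices h m Q p = core_vertices h m Q \<union> Pendant ` {..<p}"

lemma highway_vertices_iff [simp]:
  "Row \<sigma> i j \<in> highway_vertices h m Q p \<longleftrightarrow> i < m \<and> j < 2 ^ h"
  "Tree e k \<in> highway_vertices h m Q p \<longleftrightarrow> e \<le> h \<and> k < 2 ^ (h - e)"
  "Tail q \<in> highway_vertices h m Q p \<longleftrightarrow> q < Q"
  "Pendant r \<in> highway_vertices h m Q p \<longleftrightarrow> r < p"
  by (auto simp: highway_vertices_def core_vertices_def image_iff)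

lemma finite_core_vertices: "finite (core_vertices h m Q)"
  by (auto simp: core_vertices_def)

lemma finite_highway_vertices: "finite (highway_vertices h m Q p)"
  by (auto simp: highway_vertices_def finite_core_vertices)

lemma card_core_vertices_le: "card (core_vertices h m Q) \<le> 2 * m * 2 ^ h + 2 ^ h * 2 ^ h + Q"
proof -
  let ?rows = "(UNIV :: bool set) \<times> {..<m} \<times> {..<2 ^ h :: nat}"
  let ?tree = "SIGMA e:{..h}. {..<2 ^ (h - e) :: nat}"
  have "card ?rows = 2 * m * 2 ^ h" by (simp add: card_cartesian_product)
  then have rows: "card ((\<lambda>(\<sigma>, i, j). Row \<sigma> i j) ` ?rows) \<le> 2 * m * 2 ^ h"
    using card_image_le[of ?rows "\<lambda>(\<sigma>, i, j). Row \<sigma> i j"] by simp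
  have "card ?tree = (\<Sum>e\<le>h. 2 ^ (h - e))" by simp
  also have "\<dots> \<le> (\<Sum>e\<le>h. 2 ^ h)" by (intro sum_mono power_increasing) auto
  also have "\<dots> = Suc h * 2 ^ h" by simp
  also have "\<dots> \<le> 2 ^ h * 2 ^ h"
    using less_exp[of h] by (intro mult_right_mono) (auto simp: Suc_le_eq)
  finally have tree: "card ((\<lambda>(e, k). Tree e k) ` ?tree) \<le> 2 ^ h * 2 ^ h"
    using card_image_le[of ?tree "\<lambda>(e, k). Tree e k"] by (auto intro: order_trans)
  have tail: "card (Tail ` {..<Q}) \<le> Q" using card_image_le[of "{..<Q}" Tail] by simp
  show ?thesis unfolding core_vertices_def
    using rows tree tail by (intro order_trans[OF card_Un_le] add_mono) auto
qed

lemma exists_highway_vertices: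
  assumes "2 * m * 2 ^ h + 2 ^ h * 2 ^ h + Q \<le> n"
  shows "\<exists>p. card (highway_vertices h m Q p) = n"
proof -
  have "core_vertices h m Q \<inter> Pendant ` {..<p} = {}" for p by (auto simp: core_vertices_def)
  then have "card (highway_vertices h m Q p) = card (core_vertices h m Q) + p" for p
    by (simp add: highway_vertices_def card_Un_disjoint finite_core_vertices card_image inj_on_def)
  then show ?thesis using card_core_vertices_le[of h m Q] assms
    by (intro exI[of _ "n - card (core_vertices h m Q)"]) simp
qed

lemma highway_edge_cases [consumes 1, case_names row rung branch root_tail root_pendant tail]:
  assumes "0 < highway_edge h a c"
  obtains \<sigma> i j where "a = Row \<sigma> i j" "c = Row \<sigma> i (Suc j)"
    | \<sigma> i j where "a = Row \<sigma> i j" "c = Tree 0 j"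
    | e k where "a = Tree e k" "c = Tree (Suc e) (k div 2)"
    | k where "a = Tree h k" "c = Tail 0"
    | k r where "a = Tree h k" "c = Pendant r"
    | q where "a = Tail q" "c = Tail (Suc q)"
  using assms by (cases a; cases c) (auto split: if_splits)

lemma row_flow_rec: "j < 2 ^ h \<Longrightarrow> row_flow h j = rung h j * row_potential h j + row_flow h (Suc j)"
  by (simp add: row_flow_def sum.atLeast_Suc_lessThan)

lemma row_flow_le: "row_flow h j \<le> 111 * 2 ^ h * 2 ^ h"
proof -
  let ?bound = "\<lambda>k. 11 * 2 ^ h + (if k = 2 ^ h - 1 then 100 * 2 ^ h * 2 ^ h else 0)"
  have "row_flow h j \<le> (\<Sum>k\<in>{j..<2 ^ h}. ?bound k)"
    unfolding row_flow_def by (intro sum_mono) (auto simp: rung_def row_potential_def)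
  also have "\<dots> \<le> (\<Sum>k\<in>{..<2 ^ h :: nat}. ?bound k)" by (intro sum_mono2) auto
  also have "\<dots> = 111 * 2 ^ h * 2 ^ h" by (simp add: sum.distrib)
  finally show ?thesis .
qed

lemma highway_edge_sym_le: "highway_edge h a c + highway_edge h c a \<le> 111 * 2 ^ h * 2 ^ h"
proof -
  have one: "1 \<le> (2::nat) ^ h" by simp
  then have "10 \<le> 111 * (2::nat) ^ h" by linarith
  then have rung: "10 * 2 ^ h \<le> 111 * 2 ^ h * (2 ^ h :: nat)" by simp
  then have "Suc 0 \<le> 111 * 2 ^ h * 2 ^ h" using one by linarith
  then show ?thesis using rung row_flow_le by (cases a; cases c) (auto simp: rung_def)
qed

definition row_sign :: "nat set \<Rightarrow> bool \<Rightarrow> nat \<Rightarrow> int" where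
  "row_sign S \<sigma> i = (if (i \<in> S) = \<sigma> then 1 else -1)"

fun highway_potential :: "nat \<Rightarrow> nat set \<Rightarrow> vertex \<Rightarrow> real" where
  "highway_potential h S (Row \<sigma> i j) = row_sign S \<sigma> i * real (row_potential h j)"
| "highway_potential h S _ = 0"

fun highway_demand :: "nat \<Rightarrow> nat set \<Rightarrow> vertex \<Rightarrow> int" where
  "highway_demand h S (Row \<sigma> i j) = (if j = 0 then row_sign S \<sigma> i * int (row_flow h 0) else 0)"
| "highway_demand h S _ = 0"

fun mirror :: "vertex \<Rightarrow> vertex" where
  "mirror (Row \<sigma> i j) = Row (\<not> \<sigma>) i j"
| "mirror a = a"

lemma mirror_mirror: "mirror (mirror a) = a"
  by (cases a) auto

lemma bij_betw_mirror: "bij_betw mirror (highway_vertices h m Q p) (highway_vertices h m Q p)"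
proof -
  have "mirror a \<in> highway_vertices h m Q p" if "a \<in> highway_vertices h m Q p" for a
    using that by (cases a) auto
  then show ?thesis by (intro bij_betw_byWitness[of _ mirror]) (auto simp: mirror_mirror)
qed

lemma highway_edge_mirror: "highway_edge h (mirror a) (mirror c) = highway_edge h a c"
  by (cases a; cases c) auto

lemma highway_potential_mirror: "highway_potential h S (mirror a) = - highway_potential h S a"
  by (cases a) (auto simp: row_sign_def)

lemma sum_eq_0_if_odd:
  fixes f :: "'a \<Rightarrow> real"
  assumes "bij_betw s A A" and "\<And>x. x \<in> A \<Longrightarrow> f (s x) = - f x"
  shows "sum f A = 0"
proof -
  have "sum f A = (\<Sum>x\<in>A. f (s x))" by (rule sum.reindex_bij_betw[OF assms(1), symmetric])
  also have "\<dots> = - sum f A" using assms(2) by (simp add: sum_negf)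
  finally show ?thesis by simp
qed

locale highway_network = labelled_network n label "highway_vertices h m Q p" "highway_edge h"
  for h m Q p n :: nat and label :: "nat \<Rightarrow> vertex" +
  assumes rows_nonempty: "0 < m" and tail_long: "h < Q"
    and order_large: "111 * 2 ^ h * 2 ^ h \<le> n ^ 2"
begin

abbreviation "V \<equiv> highway_vertices h m Q p"

lemma currents_off_rows:
  assumes "mirror a = a"
  shows "out_current (highway_potential h S) a = 0" "in_current (highway_potential h S) a = 0"
proof -
  have potential: "highway_potential h S a = 0"
    using highway_potential_mirror[of h S a] assms by simp
  have edge: "highway_edge h a (mirror c) = highway_edge h a c"
    "highway_edge h (mirror c) a = highway_edge h c a" for c
    using highway_edge_mirror[of h a c] highway_edge_mirror[of h c a] assms by simp_all
  show "out_current (highway_potential h S) a = 0" "in_current (highway_potential h S) a = 0"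
    unfolding out_current_def in_current_def
    by (rule sum_eq_0_if_odd[OF bij_betw_mirror],
        simp add: edge highway_potential_mirror potential)+
qed

lemma row_potential_drop:
  "Suc j < 2 ^ h \<Longrightarrow> real (row_potential h j) - real (row_potential h (Suc j)) = 1"
  by (simp add: row_potential_def of_nat_diff)

lemma out_current_row:
  assumes ij: "i < m" "j < 2 ^ h"
  shows "out_current (highway_potential h S) (Row \<sigma> i j) = row_sign S \<sigma> i * real (row_flow h j)"
proof -
  have "out_current (highway_potential h S) (Row \<sigma> i j) = (\<Sum>c\<in>V.
      (if c = Row \<sigma> i (Suc j) then row_sign S \<sigma> i * real (row_flow h (Suc j)) else 0)
      + (if c = Tree 0 j then row_sign S \<sigma> i * real (rung h j * row_potential h j) else 0))"
    unfolding out_current_def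
  proof (rule sum.cong)
    fix c assume c: "c \<in> V"
    show "real (highway_edge h (Row \<sigma> i j) c)
          * (highway_potential h S (Row \<sigma> i j) - highway_potential h S c)
        = (if c = Row \<sigma> i (Suc j) then row_sign S \<sigma> i * real (row_flow h (Suc j)) else 0)
          + (if c = Tree 0 j then row_sign S \<sigma> i * real (rung h j * row_potential h j) else 0)"
      using c row_potential_drop[of j] by (cases c) (auto simp flip: right_diff_distrib)
  qed simp
  also have "\<dots> = (if Suc j < 2 ^ h then row_sign S \<sigma> i * real (row_flow h (Suc j)) else 0)
      + row_sign S \<sigma> i * real (rung h j * row_potential h j)"
    using ij by (simp add: sum.distrib sum.delta finite_highway_vertices)
  also have "\<dots> = row_sign S \<sigma> i * real (row_flow h j)"
  proof (cases "Suc j < 2 ^ h")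
    case False
    then have "Suc j = 2 ^ h" using ij by simp
    then have "row_flow h (Suc j) = 0" by (simp add: row_flow_def)
    then show ?thesis using ij False by (simp add: row_flow_rec)
  qed (use ij in \<open>simp add: row_flow_rec algebra_simps\<close>)
  finally show ?thesis .
qed

lemma in_current_row:
  assumes ij: "i < m" "j < 2 ^ h"
  shows "in_current (highway_potential h S) (Row \<sigma> i j)
    = (if j = 0 then 0 else row_sign S \<sigma> i * real (row_flow h j))"
proof -
  have "in_current (highway_potential h S) (Row \<sigma> i j) = (\<Sum>c\<in>V. if c = Row \<sigma> i (j - 1)
      then (if j = 0 then 0 else row_sign S \<sigma> i * real (row_flow h j)) else 0)"
    unfolding in_current_def
  proof (rule sum.cong)
    fix c assume c: "c \<in> V"
    show "real (highway_edge h c (Row \<sigma> i j))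
          * (highway_potential h S c - highway_potential h S (Row \<sigma> i j))
        = (if c = Row \<sigma> i (j - 1)
          then (if j = 0 then 0 else row_sign S \<sigma> i * real (row_flow h j)) else 0)"
      using ij row_potential_drop[of "j - 1"] by (cases c) (auto simp flip: right_diff_distrib)
  qed simp
  also have "\<dots> = (if j = 0 then 0 else row_sign S \<sigma> i * real (row_flow h j))"
    using ij by (simp add: sum.delta finite_highway_vertices)
  finally show ?thesis .
qed

lemma drives_highway_potential: "drives (highway_potential h S) (highway_demand h S)"
  unfolding drives_def
proof
  fix a assume "a \<in> V"
  then show "out_current (highway_potential h S) a - in_current (highway_potential h S) a
      = highway_demand h S a"
    by (cases a) (auto simp: out_current_row in_current_row currents_off_rows)
qed

lemma energy_highway_potential:
  "energy (highway_potential h S) = 2 * real m * row_potential h 0 * row_flow h 0"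
proof -
  let ?sources = "(\<lambda>(\<sigma>, i). Row \<sigma> i 0) ` (UNIV \<times> {..<m})"
  let ?power = "\<lambda>a. highway_potential h S a * real_of_int (highway_demand h S a)"
  have "energy (highway_potential h S) = sum ?power V"
    by (rule energy_if_drives[OF drives_highway_potential])
  also have "\<dots> = sum ?power ?sources"
  proof (intro sum.mono_neutral_right ballI)
    fix a assume a: "a \<in> V - ?sources"
    then have "a \<noteq> Row \<sigma> i 0" if "i < m" for \<sigma> i using that by (auto simp: image_iff)
    then show "?power a = 0" using a by (cases a) auto
  qed (auto simp: finite_highway_vertices)
  also have "\<dots> = (\<Sum>(\<sigma>, i)\<in>UNIV \<times> {..<m}. ?power (Row \<sigma> i 0))"
    by (subst sum.reindex) (auto simp: inj_on_def intro!: sum.cong)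
  also have "\<dots> = (\<Sum>(\<sigma>, i)\<in>(UNIV :: bool set) \<times> {..<m}.
      real (row_potential h 0) * real (row_flow h 0))"
    by (intro sum.cong) (auto simp: row_sign_def)
  also have "\<dots> = 2 * real m * row_potential h 0 * row_flow h 0"
    by (simp add: card_cartesian_product split_def)
  finally show ?thesis .
qed

lemma energy_highway_potential_le:
  "energy (highway_potential h S) \<le> 2442 * real m * (2 ^ h) ^ 3"
proof -
  have "row_potential h 0 * row_flow h 0 \<le> (11 * 2 ^ h) * (111 * 2 ^ h * 2 ^ h)"
    using row_flow_le by (intro mult_mono) (auto simp: row_potential_def)
  then have "real (row_potential h 0 * row_flow h 0) \<le> real ((11 * 2 ^ h) * (111 * 2 ^ h * 2 ^ h))"
    by (simp only: of_nat_le_iff)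
  then have "real (row_potential h 0) * real (row_flow h 0) \<le> 1221 * (2 ^ h) ^ 3"
    by (simp add: power3_eq_cube)
  then have "2 * real m * (real (row_potential h 0) * real (row_flow h 0))
      \<le> 2 * real m * (1221 * (2 ^ h) ^ 3)"
    by (rule mult_left_mono) simp
  then show ?thesis by (simp add: energy_highway_potential mult.assoc)
qed

lemma order_pos: "0 < n"
  using order_large by (cases n) auto

lemma weight_le:
  assumes "2 \<le> \<kappa>"
  shows "111 * 2 ^ h * 2 ^ h \<le> n ^ \<kappa>"
proof -
  have "n ^ 2 \<le> n ^ \<kappa>" using order_pos assms by (intro power_increasing) auto
  with order_large show ?thesis by (rule order_trans)
qed

lemma valid_highway_demand:
  assumes "2 \<le> \<kappa>"
  shows "valid_rhs \<kappa> net (highway_demand h S \<circ> label)"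
proof -
  have "row_flow h 0 \<le> n ^ \<kappa>" using row_flow_le weight_le[OF assms] by (rule order_trans)
  then have "int (row_flow h 0) \<le> int n ^ \<kappa>" by (simp flip: of_nat_power)
  then have "\<bar>highway_demand h S a\<bar> \<le> int n ^ \<kappa>" for a
    by (cases a) (auto simp: row_sign_def)
  then show ?thesis by (simp add: valid_rhs_def)
qed

fun altitude :: "vertex \<Rightarrow> int" where
  "altitude (Row \<sigma> i j) = int h + 1"
| "altitude (Tree e k) = int h - int e"
| "altitude (Tail q) = - int q - 1"
| "altitude (Pendant r) = 1"

lemma altitude_lipschitz:
  assumes "c \<in> V" "0 < highway_edge h a c"
  shows "\<bar>altitude a - altitude c\<bar> \<le> 1"
  using assms(2,1) by (cases rule: highway_edge_cases) auto

lemma tree_walk_to_root: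
  assumes "d \<le> h" "k < 2 ^ d"
  shows "(Tree (h - d) k, Tree h 0) \<in> link ^^ d"
  using assms
proof (induction d arbitrary: k)
  case (Suc d)
  have height: "h - d = Suc (h - Suc d)" using Suc.prems by simp
  have parent: "k div 2 < 2 ^ d"
    using Suc.prems by (simp add: less_mult_imp_div_less mult.commute)
  have "(Tree (h - Suc d) k, Tree (h - d) (k div 2)) \<in> link"
    using Suc.prems height parent by (auto simp: link_def)
  moreover have "(Tree (h - d) (k div 2), Tree h 0) \<in> link ^^ d"
    using Suc.IH Suc.prems parent by simp
  ultimately show ?case by (rule relpow_Suc_I2)
qed simp

lemma tail_walk: "q + k < Q \<Longrightarrow> (Tail (q + k), Tail q) \<in> link ^^ k"
proof (induction k)
  case (Suc k)
  then have "(Tail (q + k), Tail q) \<in> link ^^ k" "(Tail (q + Suc k), Tail (q + k)) \<in> link"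
    by (auto simp: link_def)
  then show ?case by (meson relpow_Suc_I2)
qed simp

lemma walk_to_root:
  assumes "a \<in> V"
  shows "(a, Tree h 0) \<in> link ^^ nat \<bar>altitude a\<bar>"
proof (cases a)
  case (Row \<sigma> i j)
  then have "(a, Tree 0 j) \<in> link" using assms by (auto simp: link_def rung_def)
  moreover have "(Tree 0 j, Tree h 0) \<in> link ^^ h" using tree_walk_to_root[of h j] assms Row by simp
  ultimately have "(a, Tree h 0) \<in> link ^^ Suc h" by (rule relpow_Suc_I2)
  then show ?thesis by (simp add: Row nat_add_distrib)
next
  case (Tree e k)
  then show ?thesis using tree_walk_to_root[of "h - e" k] assms by (simp add: nat_diff_distrib)
next
  case (Tail q)
  have "(a, Tail 0) \<in> link ^^ q" using tail_walk[of 0 q] Tail assms by simp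
  moreover have "(Tail 0, Tree h 0) \<in> link" using Tail assms by (auto simp: link_def)
  ultimately have "(a, Tree h 0) \<in> link ^^ Suc q" by (rule relpow_Suc_I)
  then show ?thesis by (simp add: Tail nat_add_distrib)
next
  case (Pendant r)
  then show ?thesis using assms by (auto simp: link_def)
qed

lemma exists_short_walk:
  assumes "a \<in> V" "c \<in> V"
  shows "\<exists>k\<le>Q + h + 1. (a, c) \<in> link ^^ k"
proof (cases "\<exists>q r. a = Tail q \<and> c = Tail r")
  case True
  then obtain q r where ac: "a = Tail q" "c = Tail r" by blast
  show ?thesis
  proof (cases "q \<le> r")
    case True
    then have "(c, a) \<in> link ^^ (r - q)" using tail_walk[of q "r - q"] assms ac by simp
    then have "(a, c) \<in> link ^^ (r - q)" by (rule relpow_sym[OF sym_link])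
    then show ?thesis using assms ac by (intro exI[of _ "r - q"]) auto
  next
    case False
    then have "(a, c) \<in> link ^^ (q - r)" using tail_walk[of r "q - r"] assms ac by simp
    then show ?thesis using assms ac by (intro exI[of _ "q - r"]) auto
  qed
next
  case False
  have "(a, c) \<in> link ^^ (nat \<bar>altitude a\<bar> + nat \<bar>altitude c\<bar>)"
    using walk_to_root[OF assms(1)] relpow_sym[OF sym_link walk_to_root[OF assms(2)]]
    by (rule relpow_trans)
  moreover have "nat \<bar>altitude a\<bar> + nat \<bar>altitude c\<bar> \<le> Q + h + 1"
    using assms False tail_long by (cases a; cases c) auto
  ultimately show ?thesis by blast
qed

lemma diam_highway_network: "diam net = Q + h + 1"
proof (rule diam_net[where \<phi> = altitude and a = "Tail (Q - 1)" and c = "Row True 0 0"])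
  show "altitude (Row True 0 0) - altitude (Tail (Q - 1)) = int (Q + h + 1)" using tail_long by simp
qed (use exists_short_walk altitude_lipschitz tail_long rows_nonempty in auto)

lemma valid_highway_network:
  assumes "2 \<le> \<kappa>"
  shows "valid_network \<kappa> net"
proof (rule valid_net)
  show "highway_edge h a c + highway_edge h c a \<le> n ^ \<kappa>" for a c
    using highway_edge_sym_le weight_le[OF assms] by (rule order_trans)
  show "highway_edge h a a = 0" for a by (cases a) auto
  show "(a, c) \<in> link\<^sup>*" if "a \<in> V" "c \<in> V" for a c
    using exists_short_walk[OF that] by (auto simp: rtrancl_power)
qed (use assms order_pos in auto)

end

section \<open>Rounds on the highway network\<close>

definition hamming_ball :: "'a set \<Rightarrow> 'a set \<Rightarrow> real \<Rightarrow> 'a set set" where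
  "hamming_ball A S r = {S'. S' \<subseteq> A \<and> real (card (sym_diff S S')) \<le> r}"

text \<open>The Chernoff-type bound \<open>1 \<le> 2 powr (r - |U|)\<close> on the ball, summed over all of \<open>Pow A\<close>.\<close>

lemma card_hamming_ball_le:
  assumes finite: "finite A" and subset: "S \<subseteq> A"
  shows "real (card (hamming_ball A S r)) \<le> (3/2) ^ card A * 2 powr r"
proof -
  let ?B = "sym_diff S ` hamming_ball A S r"
  have inj: "inj_on (sym_diff S) (hamming_ball A S r)" by (auto simp: inj_on_def)
  have "real (card (hamming_ball A S r)) = (\<Sum>U\<in>?B. 1)" using card_image[OF inj] by simp
  also have "\<dots> \<le> (\<Sum>U\<in>?B. (1/2) ^ card U * 2 powr r)"
  proof (rule sum_mono)
    fix U assume "U \<in> ?B"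
    then have "1 \<le> 2 powr (r - real (card U))"
      by (auto simp: hamming_ball_def intro: ge_one_powr_ge_zero)
    also have "\<dots> = (1/2) ^ card U * 2 powr r"
      by (simp add: powr_diff powr_realpow power_divide)
    finally show "1 \<le> (1/2) ^ card U * 2 powr r" .
  qed
  also have "\<dots> \<le> (\<Sum>U\<in>Pow A. (1/2) ^ card U * 2 powr r)"
    using finite subset by (intro sum_mono2) (auto simp: hamming_ball_def)
  also have "\<dots> = (\<Sum>U\<in>Pow A. (1/2) ^ card U) * 2 powr r"
    by (simp add: sum_distrib_right)
  also have "(\<Sum>U\<in>Pow A. (1/2 :: real) ^ card U) = (3/2) ^ card A"
    using prod_add[OF finite, of "\<lambda>_. 1/2 :: real" "\<lambda>_. 1"] by simp
  finally show ?thesis .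
qed

text \<open>
  The rows are cut off one column per round; a tree vertex drops out with the last leaf below it.
\<close>

fun remote :: "nat \<Rightarrow> vertex \<Rightarrow> bool" where
  "remote t (Row \<sigma> i j) \<longleftrightarrow> t + 1 \<le> j"
| "remote t (Tree e k) \<longleftrightarrow> (t + 1) div 2 ^ e \<le> k"
| "remote t _ \<longleftrightarrow> True"

abbreviation remote_vertices :: "nat \<Rightarrow> vertex set" where
  "remote_vertices t \<equiv> {a. remote t a}"

lemma decseq_remote_vertices: "decseq remote_vertices"
proof (rule decseq_SucI, rule subsetI)
  fix t a
  assume "a \<in> remote_vertices (Suc t)"
  moreover have "Suc t div 2 ^ e \<le> k" if "Suc (Suc t) div 2 ^ e \<le> k" for e k
    using div_le_mono[of "Suc t" "Suc (Suc t)" "2 ^ e"] that by linarith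
  ultimately show "a \<in> remote_vertices t" by (cases a) auto
qed

lemma remote_forward:
  assumes "0 < highway_edge h a c" and "remote (Suc t) a"
  shows "remote t c"
proof -
  have "remote t a" using decseq_remote_vertices assms(2) by (auto simp: decseq_Suc_iff)
  have parent: "Suc t div 2 ^ Suc e \<le> k div 2" if "Suc t div 2 ^ e \<le> k" for e k
    using div_le_mono[OF that, of 2] by (simp only: power_Suc2 div_mult2_eq)
  show ?thesis
    using assms(1) \<open>remote t a\<close>
    by (cases rule: highway_edge_cases) (auto intro: parent simp del: power_Suc)
qed

text \<open>
  Only the tree is traversed faster than one column per round, and on each of its levels only the
  last node that has already dropped out of the region can have a parent in it.
\<close>

lemma remote_backward:
  assumes edge: "0 < highway_edge h a c" and early: "t + 1 < 2 ^ h"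
    and receiver: "remote (Suc t) c" and sender: "\<not> remote t a"
  shows "\<exists>e. a = Tree e (2 * ((t + 2) div 2 ^ Suc e)) \<and> c = Tree (Suc e) ((t + 2) div 2 ^ Suc e)"
  using edge
proof (cases rule: highway_edge_cases)
  case (branch e k)
  define q where "q = (t + 2) div 2 ^ e"
  have half: "(t + 2) div 2 ^ Suc e = q div 2"
    by (simp only: power_Suc2 div_mult2_eq q_def)
  have "k < (t + 1) div 2 ^ e" using sender branch by simp
  also have "\<dots> \<le> q" unfolding q_def by (rule div_le_mono) simp
  finally have "k < q" .
  moreover have "q div 2 \<le> k div 2" using receiver branch half by simp
  ultimately have "k = 2 * (q div 2)" "k div 2 = q div 2" by presburger+
  then show ?thesis using branch half by auto
qed (use sender receiver early in auto)

context highway_network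
begin

lemma card_link_crossing_remote_le:
  assumes early: "T + 1 < 2 ^ h"
  shows "card (link_crossing remote_vertices T) \<le> T * h"
proof -
  let ?f = "\<lambda>(t, e).
    (t, Tree e (2 * ((t + 2) div 2 ^ Suc e)), Tree (Suc e) ((t + 2) div 2 ^ Suc e))"
  have "link_crossing remote_vertices T \<subseteq> ?f ` ({..<T} \<times> {..<h})"
  proof
    fix z assume "z \<in> link_crossing remote_vertices T"
    then obtain t a c where z: "z = (t, a, c)" and t: "t < T" and link: "(a, c) \<in> link"
      and receiver: "remote (Suc t) c" and sender: "\<not> remote t a"
      by (auto simp: link_crossing_def)
    have "highway_edge h c a = 0" using remote_forward[of h c a t] sender receiver by auto
    then have "0 < highway_edge h a c" using link by (simp add: link_def)
    then obtain e where e: "a = Tree e (2 * ((t + 2) div 2 ^ Suc e))"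
        "c = Tree (Suc e) ((t + 2) div 2 ^ Suc e)"
      using remote_backward[of h a c t] t early sender receiver by auto
    moreover have "e < h" using link e by (simp add: link_def)
    ultimately show "z \<in> ?f ` ({..<T} \<times> {..<h})"
      using t z by (intro image_eqI[of _ _ "(t, e)"]) auto
  qed
  then have "card (link_crossing remote_vertices T) \<le> card (?f ` ({..<T} \<times> {..<h}))"
    by (intro card_mono) auto
  also have "\<dots> \<le> card ({..<T} \<times> {..<h})" by (rule card_image_le) simp
  finally show ?thesis by simp
qed

definition last_rungs :: "nat set \<Rightarrow> (vertex \<times> vertex) set" where
  "last_rungs A = (\<lambda>(\<sigma>, i). (Row \<sigma> i (2 ^ h - 1), Tree 0 (2 ^ h - 1))) ` (UNIV \<times> A)"

lemma sum_last_rungs_drop: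
  "(\<Sum>(a, c)\<in>last_rungs (sym_diff S S'). real (highway_edge h a c)
      * ((highway_potential h S a - highway_potential h S c)
        - (highway_potential h S' a - highway_potential h S' c))\<^sup>2)
    = 8000 * real (card (sym_diff S S')) * (2 ^ h) ^ 3"
proof -
  let ?P = "last_rungs (sym_diff S S')"
  have "real (highway_edge h a c) * ((highway_potential h S a - highway_potential h S c)
      - (highway_potential h S' a - highway_potential h S' c))\<^sup>2 = 4000 * (2 ^ h) ^ 3"
    if "(a, c) \<in> ?P" for a c
    using that
    by (auto simp: last_rungs_def rung_def row_potential_def row_sign_def power2_eq_square
        power3_eq_cube)
  moreover have "card ?P = 2 * card (sym_diff S S')"
    unfolding last_rungs_def by (subst card_image) (auto simp: inj_on_def card_cartesian_product)
  ultimately show ?thesis by (simp add: split_def)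
qed

text \<open>At least \<open>2000/2442\<close> of the energy sits in the last rungs.\<close>

lemma card_sym_diff_le_third:
  fixes \<kappa> :: nat
  assumes exponent: "2 \<le> \<kappa>" and accuracy: "\<epsilon> \<le> 1/2" and early: "r + 1 < 2 ^ h"
    and subsets: "S \<subseteq> {..<m}" "S' \<subseteq> {..<m}"
    and consistent:
      "S \<in> consistent_demands \<epsilon> (highway_demand h) (remote_vertices r) x"
      "S' \<in> consistent_demands \<epsilon> (highway_demand h) (remote_vertices r) x"
  shows "real (card (sym_diff S S')) \<le> real m / 3"
proof -
  let ?P = "last_rungs (sym_diff S S')"
  have "?P \<subseteq> (V \<inter> remote_vertices r) \<times> (V \<inter> remote_vertices r)"
    using subsets early by (auto simp: last_rungs_def)
  from consistent_demands_separation[OF valid_highway_network[OF exponent] accuracy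
      drives_highway_potential drives_highway_potential consistent this]
  have "8000 * real (card (sym_diff S S')) * (2 ^ h) ^ 3
      \<le> (energy (highway_potential h S) + energy (highway_potential h S')) / 2"
    unfolding sum_last_rungs_drop .
  also have "\<dots> \<le> 2442 * real m * (2 ^ h) ^ 3"
    using energy_highway_potential_le[of S] energy_highway_potential_le[of S'] by simp
  finally have "8000 * real (card (sym_diff S S')) \<le> 2442 * real m"
    by (rule mult_right_le_imp_le) simp
  then show ?thesis by simp
qed

lemma card_consistent_signs_le:
  fixes \<kappa> :: nat
  assumes exponent: "2 \<le> \<kappa>" and accuracy: "\<epsilon> \<le> 1/2" and early: "r + 1 < 2 ^ h"
  shows "real (card (Pow {..<m} \<inter> consistent_demands \<epsilon> (highway_demand h) (remote_vertices r) x))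
      \<le> (3/2) ^ m * 2 powr (real m / 3)"
    (is "real (card ?C) \<le> _")
proof (cases "?C = {}")
  case False
  then obtain S where S: "S \<in> ?C" by blast
  have "?C \<subseteq> hamming_ball {..<m} S (real m / 3)"
    using S card_sym_diff_le_third[OF exponent accuracy early] by (auto simp: hamming_ball_def)
  moreover have "finite (hamming_ball {..<m} S (real m / 3))"
    by (rule finite_subset[of _ "Pow {..<m}"]) (auto simp: hamming_ball_def)
  ultimately have "card ?C \<le> card (hamming_ball {..<m} S (real m / 3))" by (rule card_mono[rotated])
  then show ?thesis
    using card_hamming_ball_le[of "{..<m}" S "real m / 3"] S by simp
qed simp

lemma sign_patterns_counting_bound:
  assumes congest: "congest \<beta> A" and solves: "solves_laplacian_within \<kappa> \<epsilon> A T"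
    and exponent: "2 \<le> \<kappa>" and accuracy: "\<epsilon> \<le> 1/2" and early: "T n (Q + h + 1) + 1 < 2 ^ h"
  shows "2/3 * 2 ^ m \<le> 2 ^ (Suc (bandwidth \<beta> n) * (T n (Q + h + 1) * h))
    * ((3/2) ^ m * 2 powr (real m / 3))"
proof -
  have "2/3 * real (card (Pow {..<m})) \<le> 2 ^ (Suc (bandwidth \<beta> n) * (T n (Q + h + 1) * h))
    * ((3/2) ^ m * 2 powr (real m / 3))"
  proof (rule link_crossing_counting_bound[OF congest solves valid_highway_network[OF exponent]])
    show "decseq remote_vertices" by (rule decseq_remote_vertices)
    show "highway_demand h S a = highway_demand h S' a" if "a \<in> remote_vertices 0" for S S' a
      using that by (cases a) auto
    show "T n (Q + h + 1) = T n (diam net)" by (simp add: diam_highway_network)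
  qed (use valid_highway_demand[OF exponent] card_link_crossing_remote_le[OF early]
      card_consistent_signs_le[OF exponent accuracy early] in auto)
  then show ?thesis by (simp add: card_Pow)
qed

end

section \<open>The lower bound\<close>

lemma three_halves_power_le: "(3/2 :: real) ^ m \<le> 2 powr (3/5 * real m)"
proof -
  have "(2 powr (3/5 :: real)) ^ 5 = (2 :: real) powr (real 5 * (3/5))" by (rule powr_power) simp
  then have "(3/2 :: real) ^ 5 \<le> (2 powr (3/5)) ^ 5" by (simp add: power_numeral_reduce)
  then have "(3/2 :: real) \<le> 2 powr (3/5)" by (simp add: power_mono_iff)
  then have "(3/2 :: real) ^ m \<le> (2 powr (3/5)) ^ m" by (rule power_mono) simp
  also have "\<dots> = 2 powr (real m * (3/5))" by (rule powr_power) simp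
  finally show ?thesis by (simp add: mult.commute)
qed

lemma covering_exponent_ge:
  assumes "2/3 * 2 ^ m \<le> 2 ^ N * ((3/2) ^ m * 2 powr (real m / 3))"
  shows "real m / 15 - 1 \<le> real N"
proof -
  have "2 powr (real m - 1) \<le> 2/3 * (2::real) ^ m" by (simp add: powr_diff powr_realpow)
  also have "\<dots> \<le> 2 ^ N * ((3/2) ^ m * 2 powr (real m / 3))" by (rule assms)
  also have "\<dots> \<le> 2 powr real N * (2 powr (3/5 * real m) * 2 powr (real m / 3))"
    using three_halves_power_le by (simp add: powr_realpow)
  also have "\<dots> = 2 powr (real N + (3/5 * real m + real m / 3))" by (simp only: powr_add)
  finally have "real m - 1 \<le> real N + (3/5 * real m + real m / 3)" by simp
  then show ?thesis by simp
qed

lemma (in highway_network) pairs_le_rounds: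
  assumes congest: "congest \<beta> A" and solves: "solves_laplacian_within \<kappa> \<epsilon> A T"
    and exponent: "2 \<le> \<kappa>" and accuracy: "\<epsilon> \<le> 1/2" and pairs: "30 \<le> m" "m \<le> 2 ^ h"
  shows "m \<le> 30 * (Suc (bandwidth \<beta> n) * (T n (Q + h + 1) * Suc h))"
proof (cases "T n (Q + h + 1) + 1 < 2 ^ h")
  case True
  have "real m / 15 - 1 \<le> real (Suc (bandwidth \<beta> n) * (T n (Q + h + 1) * h))"
    using sign_patterns_counting_bound[OF congest solves exponent accuracy True]
    by (rule covering_exponent_ge)
  then have "real m \<le> real (30 * (Suc (bandwidth \<beta> n) * (T n (Q + h + 1) * h)))"
    using pairs(1) by simp
  then have "m \<le> 30 * (Suc (bandwidth \<beta> n) * (T n (Q + h + 1) * h))" by (simp only: of_nat_le_iff)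
  also have "\<dots> \<le> 30 * (Suc (bandwidth \<beta> n) * (T n (Q + h + 1) * Suc h))"
    by (intro mult_le_mono) auto
  finally show ?thesis .
next
  case False
  then have "m \<le> 30 * (1 * (T n (Q + h + 1) * 1))" using pairs by simp
  also have "\<dots> \<le> 30 * (Suc (bandwidth \<beta> n) * (T n (Q + h + 1) * Suc h))"
    by (intro mult_le_mono) auto
  finally show ?thesis .
qed

lemma Suc_bandwidth_le:
  assumes "1 \<le> ln (real n)"
  shows "real (Suc (bandwidth \<beta> n)) \<le> (2 * \<bar>\<beta>\<bar> + 1) * ln (real n)"
proof -
  have "log 2 (real n) \<le> 2 * ln (real n)"
    using ln2_ge_two_thirds assms by (simp add: log_def field_simps)
  moreover have "0 \<le> log 2 (real n)" using assms by (simp add: log_def)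
  ultimately have "\<bar>\<beta> * log 2 (real n)\<bar> \<le> \<bar>\<beta>\<bar> * (2 * ln (real n))"
    unfolding abs_mult by (intro mult_left_mono) auto
  moreover have "real (bandwidth \<beta> n) \<le> \<bar>\<beta> * log 2 (real n)\<bar>"
    unfolding bandwidth_def by linarith
  ultimately show ?thesis using assms by (simp add: algebra_simps)
qed

lemma exists_tree_height:
  assumes "4 \<le> n"
  shows "\<exists>h. 4 * 4 ^ h \<le> n \<and> sqrt (real n) \<le> 4 * 2 ^ h \<and> real h + 1 \<le> ln (real n)"
proof -
  obtain k where k: "4 ^ k \<le> n" "n < 4 ^ (k + 1)"
    using ex_power_ivl1[of 4 n] assms by auto
  then obtain h where h: "k = Suc h" using assms by (cases k) auto
  have "real n \<le> real (4 ^ (k + 1))" using k(2) by (simp only: of_nat_le_iff less_imp_le)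
  also have "\<dots> = (4 * 2 ^ h)\<^sup>2" by (simp add: h power2_eq_square flip: power_mult_distrib)
  finally have sqrt_n: "sqrt (real n) \<le> 4 * 2 ^ h" by (intro real_le_lsqrt) auto
  have "real k * 1 \<le> real k * ln 4"
    using exp_le by (intro mult_left_mono) (simp_all add: ln_ge_iff)
  then have "real k \<le> ln (real (4 ^ k))" by (simp add: ln_realpow)
  also have "\<dots> \<le> ln (real n)" using k(1) by (intro ln_mono of_nat_mono) auto
  finally show ?thesis using k(1) sqrt_n by (intro exI[of _ h]) (simp add: h)
qed

lemma exists_highway_network:
  assumes order: "14400 \<le> n" and diameter: "2 * ln (real n) \<le> real D" "real D < sqrt (real n)"
  shows "\<exists>h p label. highway_network h (2 ^ h) (D - h - 1) p n label \<and> h + 1 \<le> D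
    \<and> sqrt (real n) \<le> 4 * 2 ^ h \<and> real h + 1 \<le> ln (real n)"
proof -
  obtain h where h: "4 * 4 ^ h \<le> n" "sqrt (real n) \<le> 4 * 2 ^ h" "real h + 1 \<le> ln (real n)"
    using exists_tree_height[of n] order by auto
  have squares: "(4::nat) ^ h = 2 ^ h * 2 ^ h" by (simp flip: power_mult_distrib)
  have "real (2 * (h + 1)) \<le> real D" using diameter(1) h(3) by simp
  then have height: "2 * (h + 1) \<le> D" by (simp only: of_nat_le_iff)
  have "sqrt (real (4 ^ 2)) \<le> sqrt (real n)" using order by (intro real_sqrt_le_mono) simp
  then have "4 * sqrt (real n) \<le> sqrt (real n) * sqrt (real n)" by (intro mult_right_mono) auto
  then have "real (4 * D) \<le> real n" using diameter(2) by simp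
  then have "4 * D \<le> n" by (simp only: of_nat_le_iff)
  then have "2 * 2 ^ h * 2 ^ h + 2 ^ h * 2 ^ h + (D - h - 1) \<le> n" using h(1) squares by simp
  then obtain p where p: "card (highway_vertices h (2 ^ h) (D - h - 1) p) = n"
    using exists_highway_vertices by blast
  then obtain label where "bij_betw label {..<n} (highway_vertices h (2 ^ h) (D - h - 1) p)"
    using ex_bij_betw_nat_finite[OF finite_highway_vertices, of h "2 ^ h" "D - h - 1" p]
    by (auto simp: atLeast0LessThan)
  moreover have "111 * 2 ^ h * 2 ^ h \<le> n ^ 2"
  proof -
    have "111 * (2 ^ h * 2 ^ h) \<le> 28 * n" using h(1) squares by simp
    also have "\<dots> \<le> n * n" using order by (intro mult_right_mono) auto
    finally show ?thesis by (simp add: power2_eq_square)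
  qed
  ultimately have "highway_network h (2 ^ h) (D - h - 1) p n label"
    using height by unfold_locales auto
  then show ?thesis using h height by (intro exI[of _ h] exI[of _ p] exI[of _ label]) auto
qed

lemma sqrt_le_rounds:
  assumes congest: "congest \<beta> A" and solves: "solves_laplacian_within \<kappa> \<epsilon> A T"
    and exponent: "2 \<le> \<kappa>" and accuracy: "\<epsilon> \<le> 1/2"
    and order: "14400 \<le> n" and diameter: "2 * ln (real n) \<le> real D" "real D < sqrt (real n)"
  shows "sqrt (real n) \<le> 120 * (2 * \<bar>\<beta>\<bar> + 1) * ln (real n) ^ 2 * T n D"
proof -
  obtain h p label where network: "highway_network h (2 ^ h) (D - h - 1) p n label"
    and height: "h + 1 \<le> D" and sqrt_n: "sqrt (real n) \<le> 4 * 2 ^ h"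
    and height_le_ln: "real h + 1 \<le> ln (real n)"
    using exists_highway_network[OF order diameter] by blast
  have "sqrt (real (120 ^ 2)) \<le> sqrt (real n)" using order by (intro real_sqrt_le_mono) simp
  then have "30 \<le> (2 :: real) ^ h" using sqrt_n by simp
  then have "real 30 \<le> real (2 ^ h)" by simp
  then have "30 \<le> (2 :: nat) ^ h" by (simp only: of_nat_le_iff)
  then have "2 ^ h \<le> 30 * (Suc (bandwidth \<beta> n) * (T n D * Suc h))"
    using highway_network.pairs_le_rounds[OF network congest solves exponent accuracy] height
    by simp
  then have "real (2 ^ h) \<le> real (30 * (Suc (bandwidth \<beta> n) * (T n D * Suc h)))"
    by (simp only: of_nat_le_iff)
  also have "\<dots> = 30 * (real (Suc (bandwidth \<beta> n)) * real (Suc h)) * T n D"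
    by (simp only: of_nat_mult of_nat_numeral mult_ac)
  also have "\<dots> \<le> 30 * ((2 * \<bar>\<beta>\<bar> + 1) * ln (real n) * ln (real n)) * T n D"
    using height_le_ln Suc_bandwidth_le[of n \<beta>]
    by (intro mult_right_mono mult_left_mono mult_mono) auto
  finally show ?thesis using sqrt_n by (simp add: power2_eq_square algebra_simps)
qed

lemma diameter_le_rounds:
  assumes congest: "congest \<beta> A" and solves: "solves_laplacian_within \<kappa> \<epsilon> A T"
    and exponent: "1 \<le> \<kappa>" and accuracy: "\<epsilon> \<le> 1/2" and long: "6 \<le> D" "D < n"
  shows "D \<le> 6 * T n D"
proof -
  interpret path_network n D using long by unfold_locales auto
  show ?thesis using rounds_ge_half_length[OF congest solves exponent accuracy] long(1) by linarith
qed

lemma sqrt_plus_diameter_le_rounds: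
  assumes congest: "congest \<beta> A" and solves: "solves_laplacian_within \<kappa> \<epsilon> A T"
    and exponent: "2 \<le> \<kappa>" and accuracy: "\<epsilon> \<le> 1/2"
    and order: "14400 \<le> n" and diameter: "2 * ln (real n) \<le> real D" "D < n"
  shows "sqrt (real n) + real D \<le> 240 * (2 * \<bar>\<beta>\<bar> + 1) * ln (real n) ^ 2 * T n D"
proof (cases "real D < sqrt (real n)")
  case True
  then show ?thesis
    using sqrt_le_rounds[OF congest solves exponent accuracy order diameter(1)] by linarith
next
  case False
  have "exp 1 \<le> real n" using exp_le order by linarith
  then have "1 \<le> ln (real n)" using order by (subst ln_ge_iff) auto
  then have factor: "1 * 1 \<le> (2 * \<bar>\<beta>\<bar> + 1) * ln (real n) ^ 2" by (intro mult_mono) auto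
  have "sqrt (real (120 ^ 2)) \<le> sqrt (real n)" using order by (intro real_sqrt_le_mono) simp
  then have "120 \<le> D" using False by simp
  then have "D \<le> 6 * T n D"
    using exponent diameter(2) by (intro diameter_le_rounds[OF congest solves _ accuracy]) auto
  then have "sqrt (real n) + real D \<le> 240 * (1 * 1) * real (T n D)" using False by simp
  also have "\<dots> \<le> 240 * ((2 * \<bar>\<beta>\<bar> + 1) * ln (real n) ^ 2) * real (T n D)"
    using factor by (intro mult_right_mono mult_left_mono) auto
  finally show ?thesis by (simp add: mult_ac)
qed

theorem theorem1p2:
  shows "\<exists>(\<kappa>\<^sub>0::nat) (k::nat) (C::real). C > 0 \<and>
    (\<forall>\<kappa>\<ge>\<kappa>\<^sub>0. \<forall>\<beta>::real. \<exists>(c::real) (n\<^sub>0::nat). c > 0 \<and>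
      (\<forall>A \<epsilon> T. congest \<beta> A \<longrightarrow> \<epsilon> \<le> 1/2 \<longrightarrow> solves_laplacian_within \<kappa> \<epsilon> A T \<longrightarrow>
        (\<forall>n\<ge>n\<^sub>0. \<forall>D<n. C * ln (real n) \<le> real D \<longrightarrow>
           real (T n D) \<ge> c * (sqrt (real n) + real D) / ln (real n) ^ k)))"
proof (rule exI[of _ 2], rule exI[of _ 2], rule exI[of _ 2], intro conjI allI impI)
  fix \<kappa> :: nat and \<beta> :: real
  assume exponent: "2 \<le> \<kappa>"
  let ?c = "1 / (240 * (2 * \<bar>\<beta>\<bar> + 1))"
  have rounds: "?c * (sqrt (real n) + real D) / ln (real n) ^ 2 \<le> real (T n D)"
    if "congest \<beta> A" "\<epsilon> \<le> 1/2" "solves_laplacian_within \<kappa> \<epsilon> A T"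
      and "14400 \<le> n" "D < n" "2 * ln (real n) \<le> real D" for A \<epsilon> T n D
  proof -
    have "0 < 240 * (2 * \<bar>\<beta>\<bar> + 1) * ln (real n) ^ 2" using that by (intro mult_pos_pos) auto
    then show ?thesis
      using sqrt_plus_diameter_le_rounds[OF that(1,3) exponent that(2,4,6,5)]
      by (simp add: pos_divide_le_eq mult_ac)
  qed
  show "\<exists>c n\<^sub>0. 0 < c \<and> (\<forall>A \<epsilon> T. congest \<beta> A \<longrightarrow> \<epsilon> \<le> 1/2 \<longrightarrow> solves_laplacian_within \<kappa> \<epsilon> A T \<longrightarrow>
      (\<forall>n\<ge>n\<^sub>0. \<forall>D<n. 2 * ln (real n) \<le> real D \<longrightarrow>
        c * (sqrt (real n) + real D) / ln (real n) ^ 2 \<le> real (T n D)))"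
    by (rule exI[of _ ?c], rule exI[of _ 14400]) (use rounds in auto)
qed simp

end
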